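(* Let $M=c'T$ for some constant $c'$. Any streaming algorithm that achieves constant regret for the experts problem with $n$ experts and $T$ days with probability at least $1-2^{-\Theta(T)}$ must use at least $\Omega(n)$ space, where the best expert makes $M$ mistakes.
   Context: Experts problem (streaming, discrete predictions). There are $n$ experts and $T$ days. On each day, the algorithm receives the predictions of all $n$ experts (elements of a fixed finite set, e.g. $\{0,1\}$), outputs its own prediction, and then the correct outcome is revealed. A prediction costs $0$ if it equals the outcome and $1$ otherwise (a mistake). The number of mistakes of the best expert is the minimum over experts of the total number of mistakes made over the $T$ days; it is denoted $M$. Regret is amortized over days: the algorithm achieves regret $R$ if its total number of mistakes exceeds that of the best expert by at most $RT$; constant regret means $R$ is a constant. The algorithm may be randomized; the success probability is over its internal randomness, for each fixed input stream. Space is the number of bits of memory the algorithm keeps while processing the stream. Here $2^{-\Theta(T)}$ means $2^{-aT}$ for a constant $a>0$, and the constant in $\Omega(\cdot)$ may depend on the constants involved.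
   Formalization: Assumes c' > 0 and c' + R < 1 - 1/q, with q the number of possible predictions (1/2 if binary): for M = 0 pooling experts needs o(n) space, and for c' + R > 1 - 1/q random guessing without memory succeeds with probability 1 - 2^{-Θ(T)}. *)

theory Defs
  imports "HOL-Probability.Probability_Mass_Function"
begin

text \<open>
  An input is the list of its days. A day is a pair \<open>(x, y)\<close>: the list \<open>x\<close> of the predictions of
  the experts and the correct outcome \<open>y\<close>, both over a fixed finite alphabet \<open>'p\<close>.
\<close>

type_synonym 'p expert_input = "('p list \<times> 'p) list"

definition inputs :: "nat \<Rightarrow> nat \<Rightarrow> 'p expert_input set" where
  "inputs n T = {s. length s = T \<and> (\<forall>(x, y) \<in> set s. length x = n)}"

definition expert_mistakes :: "'p expert_input \<Rightarrow> nat \<Rightarrow> nat" where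
  "expert_mistakes s i = length (filter (\<lambda>(x, y). x ! i \<noteq> y) s)"

definition best_mistakes :: "nat \<Rightarrow> 'p expert_input \<Rightarrow> nat" where
  "best_mistakes n s = Min (expert_mistakes s ` {..<n})"

text \<open>
  A streaming algorithm once its internal randomness is fixed. The memory is the bit string carried
  from one day to the next. The prediction depends only on this memory and on the predictions of the
  experts for the current day; the outcome is available only to the update. The arbitrary
  computation within a day and the index of the day are not charged to the memory, and the functions
  may depend on the number of experts and of days, so that lower bounds hold in this liberal model
  and hence in more restrictive ones.
\<close>

record 'p det_alg =
  start :: "bool list"
  predict :: "nat \<Rightarrow> bool list \<Rightarrow> 'p list \<Rightarrow> 'p"
  update :: "nat \<Rightarrow> bool list \<Rightarrow> 'p list \<Rightarrow> 'p \<Rightarrow> bool list"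

fun mistakes_from :: "'p det_alg \<Rightarrow> nat \<Rightarrow> bool list \<Rightarrow> 'p expert_input \<Rightarrow> nat" where
  "mistakes_from A t m [] = 0"
| "mistakes_from A t m ((x, y) # s) =
     (if predict A t m x = y then 0 else 1) + mistakes_from A (Suc t) (update A t m x y) s"

definition mistakes :: "'p det_alg \<Rightarrow> 'p expert_input \<Rightarrow> nat" where
  "mistakes A s = mistakes_from A 0 (start A) s"

text \<open>
  A randomized algorithm draws all of its random choices in advance and then runs deterministically,
  i.e. it is a distribution over deterministic algorithms. Coins tossed afresh each day are covered,
  because the functions of an algorithm may depend on the day. Access to the random choices is not
  charged to the memory.
\<close>

type_synonym 'p rand_alg = "'p det_alg pmf"

definition uses_memory :: "nat \<Rightarrow> nat \<Rightarrow> 'p rand_alg \<Rightarrow> bool" where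
  "uses_memory n S \<A> \<longleftrightarrow>
     (\<forall>A \<in> set_pmf \<A>. length (start A) = S \<and>
        (\<forall>t m x y. length m = S \<and> length x = n \<longrightarrow> length (update A t m x y) = S))"

text \<open>
  The input is fixed before the random choices are drawn. The guarantee is required only on the
  inputs whose best expert makes exactly \<open>M\<close> mistakes. The regret \<open>R\<close> is per day.
\<close>

definition achieves_regret ::
    "nat \<Rightarrow> nat \<Rightarrow> nat \<Rightarrow> real \<Rightarrow> real \<Rightarrow> 'p rand_alg \<Rightarrow> bool" where
  "achieves_regret n T M R p \<A> \<longleftrightarrow>
     (\<forall>s \<in> inputs n T. best_mistakes n s = M \<longrightarrow>
        measure_pmf.prob \<A> {A. real (mistakes A s) \<le> real (best_mistakes n s) + R * real T} \<ge> p)"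

end

theory Submission imports Defs begin

text \<open>
  Draw all predictions and outcomes uniformly: any algorithm then errs on about a fraction
  \<open>1 - 1/q\<close> of the days, where \<open>q\<close> is the size of the alphabet. Now plant a random expert \<open>i\<close> that
  errs only with a small positive probability. Fix the outcomes, the successive memory contents and
  the correctness of the predictions: the inputs with such a transcript form a rectangle, a product
  over the days of sets of prediction vectors, and the positive error probability bounds the
  likelihood ratio of planted against uniform from below on each factor. With \<open>S\<close> bits a typical
  transcript has probability at least \<open>2 ^ (- (S + 2) T)\<close> given the outcomes, so on average over \<open>i\<close> and over the
  days the \<open>i\<close>-th prediction is almost uniform given the transcript, and by AM-GM over \<open>i\<close> planting
  costs only a factor \<open>exp (- \<epsilon> T)\<close>, where \<open>\<epsilon>\<close> tends to \<open>0\<close> with \<open>S / n\<close>. Hence the algorithm still errs as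
  under the uniform distribution with probability much larger than \<open>2 ^ (- a T)\<close>.

  The best expert must make exactly \<open>M\<close> mistakes, for any relation between \<open>n\<close> and \<open>T\<close>. On the first
  \<open>k\<close> days all experts therefore agree on a fixed symbol \<open>b\<close> while the outcome stays uniform, which costs
  every expert close to \<open>M\<close> mistakes; a few unanimous days at the end correct the difference.
\<close>

section \<open>Elementary exponential inequalities\<close>

lemma exp_le_quadratic:
  fixes z :: real
  assumes "\<bar>z\<bar> \<le> 1"
  shows "exp z \<le> 1 + z + z\<^sup>2"
proof (cases "0 \<le> z")
  case True
  then show ?thesis using exp_bound[of z] assms by simp
next
  case False
  \<comment> \<open>For negative \<open>z\<close> the reciprocal is bounded: this lower bound for
    \<open>exp (- z)\<close> times \<open>1 + z + z\<^sup>2\<close> is at least 1, because the terms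
    of degree three and four have the right sign.\<close>
  have *: "1 - z + z\<^sup>2 / 2 \<le> exp (- z)"
    using exp_lower_Taylor_quadratic[of "- z"] False by simp
  have "z ^ 3 \<le> 0" "0 \<le> z ^ 4" using False by (auto simp: power_le_zero_eq)
  moreover have "(1 - z + z\<^sup>2 / 2) * (1 + z + z\<^sup>2) = 1 + z\<^sup>2 / 2 - z ^ 3 / 2 + z ^ 4 / 2"
    by (simp add: field_simps power2_eq_square power3_eq_cube power4_eq_xxxx)
  ultimately have "1 \<le> (1 - z + z\<^sup>2 / 2) * (1 + z + z\<^sup>2)" 
    using zero_le_power2[of z] by linarith
  also have "\<dots> \<le> exp (- z) * (1 + z + z\<^sup>2)"
  proof (rule mult_right_mono[OF *])
    have "0 \<le> 1 + z" using assms by simp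
    then show "0 \<le> 1 + z + z\<^sup>2" using zero_le_power2[of z] by linarith
  qed
  finally show ?thesis by (simp add: exp_minus field_simps)
qed

lemma sum_if_eq:
  fixes u v :: real and b :: "'p::finite"
  shows "(\<Sum>y\<in>UNIV. if b = y then u else v) = u + (real CARD('p) - 1) * v"
proof -
  have "(\<Sum>y\<in>UNIV. if b = y then u else v) = (\<Sum>y\<in>UNIV. v + (if y = b then u - v else 0))"
    by (intro sum.cong) auto
  also have "\<dots> = real CARD('p) * v + (u - v)" by (simp add: sum.distrib)
  finally show ?thesis by (simp add: algebra_simps)
qed

text \<open>A fixed guess is wrong with probability \<open>1 - 1 / q\<close> under a uniform
  outcome, so the linear term of the quadratic bound cancels. This is the sub-Gaussian estimate
  behind both two-sided deviation bounds.\<close>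

lemma sum_exp_centred_le:
  fixes b :: "'p::finite" and h :: real
  assumes "\<bar>h\<bar> \<le> 1"
  shows "(\<Sum>y\<in>UNIV. exp (h * ((if b = y then 0 else 1) - (1 - 1 / real CARD('p)))))
    \<le> real CARD('p) * exp (h\<^sup>2)"
proof -
  define q where "q = real CARD('p)"
  have q: "1 \<le> q" unfolding q_def using one_le_card_finite[where 'a='p] by linarith
  define z where "z y = (if b = y then 0 else 1) - (1 - 1 / q)" for y
  have abs: "\<bar>z y\<bar> \<le> 1" for y using q by (auto simp: z_def field_simps abs_if)
  have "exp (h * z y) \<le> 1 + h * z y + h\<^sup>2" for y
  proof -
    have "\<bar>h * z y\<bar> \<le> \<bar>h\<bar>" using abs[of y] by (simp add: abs_mult mult_left_le)
    then have "exp (h * z y) \<le> 1 + h * z y + (h * z y)\<^sup>2" using assms by (intro exp_le_quadratic) simp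
    also have "(h * z y)\<^sup>2 \<le> h\<^sup>2" using \<open>\<bar>h * z y\<bar> \<le> \<bar>h\<bar>\<close> by (simp add: abs_le_square_iff)
    finally show ?thesis by simp
  qed
  then have "(\<Sum>y\<in>UNIV. exp (h * z y)) \<le> (\<Sum>y\<in>UNIV. 1 + h * z y + h\<^sup>2)" by (rule sum_mono)
  also have "\<dots> = q + h * (\<Sum>y\<in>UNIV. z y) + q * h\<^sup>2"
    by (simp add: sum.distrib sum_distrib_left q_def)
  also have "(\<Sum>y\<in>UNIV. z y) = 0"
    using q sum_if_eq[of b 0 1] by (simp add: z_def sum_subtractf q_def[symmetric] right_diff_distrib)
  also have "q + h * 0 + q * h\<^sup>2 \<le> q * exp (h\<^sup>2)"
    using q exp_ge_add_one_self[of "h\<^sup>2"] mult_left_mono[of "1 + h\<^sup>2" "exp (h\<^sup>2)" q] by (simp add: algebra_simps)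
  finally show ?thesis by (simp add: z_def q_def)
qed

section \<open>Sums over inputs\<close>

definition predictions :: "nat \<Rightarrow> 'p list set" where
  "predictions n = {x. length x = n}"

lemma finite_predictions [simp]: "finite (predictions n :: 'p::finite list set)"
  using finite_lists_length_eq[of "UNIV :: 'p set" n] by (simp add: predictions_def)

lemma card_predictions: "card (predictions n :: 'p::finite list set) = CARD('p) ^ n"
  using card_lists_length_eq[of "UNIV :: 'p set" n] by (simp add: predictions_def)

lemma predictions_Suc: "predictions (Suc n) = (\<lambda>(b, x). b # x) ` (UNIV \<times> predictions n)"
  by (auto simp: predictions_def image_iff length_Suc_conv)

text \<open>Independence of the coordinates under the uniform distribution on prediction vectors; it
  makes the exponential tilt below computable.\<close>

lemma sum_predictions_prod:
  fixes h :: "nat \<Rightarrow> 'p::finite \<Rightarrow> real"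
  shows "(\<Sum>x\<in>predictions n. \<Prod>i<n. h i (x ! i)) = (\<Prod>i<n. \<Sum>b\<in>UNIV. h i b)"
proof (induction n arbitrary: h)
  case 0
  then show ?case by (simp add: predictions_def)
next
  case (Suc n)
  have inj: "inj_on (\<lambda>(b, x). b # x) (UNIV \<times> predictions n)" by (auto simp: inj_on_def)
  have "(\<Sum>x\<in>predictions (Suc n). \<Prod>i<Suc n. h i (x ! i)) =
      (\<Sum>(b, x)\<in>UNIV \<times> predictions n. h 0 b * (\<Prod>i<n. h (Suc i) (x ! i)))"
    unfolding predictions_Suc sum.reindex[OF inj]
    by (simp add: case_prod_unfold prod.lessThan_Suc_shift del: prod.lessThan_Suc)
  also have "\<dots> = (\<Sum>b\<in>UNIV. h 0 b) * (\<Sum>x\<in>predictions n. \<Prod>i<n. h (Suc i) (x ! i))"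
    by (simp add: sum_product sum.cartesian_product)
  also have "\<dots> = (\<Prod>i<Suc n. \<Sum>b\<in>UNIV. h i b)"
    using Suc.IH[of "\<lambda>i. h (Suc i)"] by (simp add: prod.lessThan_Suc_shift del: prod.lessThan_Suc)
  finally show ?case .
qed

lemma inputs_Suc:
  "inputs n (Suc T) = (\<lambda>((x, y), s). (x, y) # s) ` ((predictions n \<times> UNIV) \<times> inputs n T)"
  by (auto simp: inputs_def predictions_def image_iff length_Suc_conv)

lemma inputs_0 [simp]: "inputs n 0 = {[]}"
  by (auto simp: inputs_def)

lemma finite_inputs [simp]: "finite (inputs n T :: 'p::finite expert_input set)"
  by (induction T) (auto simp: inputs_Suc)

lemma sum_inputs_Suc:
  fixes f :: "'p::finite expert_input \<Rightarrow> real"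
  shows "(\<Sum>s\<in>inputs n (Suc T). f s) = (\<Sum>x\<in>predictions n. \<Sum>y\<in>UNIV. \<Sum>s\<in>inputs n T. f ((x, y) # s))"
proof -
  have inj: "inj_on (\<lambda>((x, y), s). (x, y) # s) ((predictions n \<times> UNIV) \<times> inputs n T)"
    by (auto simp: inj_on_def)
  have "(\<Sum>s\<in>inputs n (Suc T). f s) =
      (\<Sum>(d, s)\<in>(predictions n \<times> UNIV) \<times> inputs n T. f (d # s))"
    unfolding inputs_Suc sum.reindex[OF inj] by (simp add: case_prod_unfold)
  also have "\<dots> = (\<Sum>d\<in>predictions n \<times> UNIV. \<Sum>s\<in>inputs n T. f (d # s))"
    by (rule sum.cartesian_product[symmetric])
  also have "\<dots> = (\<Sum>(x, y)\<in>predictions n \<times> UNIV. \<Sum>s\<in>inputs n T. f ((x, y) # s))"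
    by (simp add: case_prod_unfold)
  also have "\<dots> = (\<Sum>x\<in>predictions n. \<Sum>y\<in>UNIV. \<Sum>s\<in>inputs n T. f ((x, y) # s))"
    by (rule sum.cartesian_product[symmetric])
  finally show ?thesis .
qed

lemma card_inputs: "card (inputs n T :: 'p::finite expert_input set) = (CARD('p) ^ (n + 1)) ^ T"
proof -
  have "real (card (inputs n T :: 'p expert_input set)) = real ((CARD('p) ^ (n + 1)) ^ T)"
  proof (induction T)
    case (Suc T)
    have "real (card (inputs n (Suc T) :: 'p expert_input set)) = (\<Sum>s\<in>(inputs n (Suc T) :: 'p expert_input set). 1)"
      by simp
    also have "\<dots> = real (CARD('p) ^ n) * (real CARD('p) * real (card (inputs n T :: 'p expert_input set)))"
      unfolding sum_inputs_Suc by (simp add: card_predictions)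
    finally show ?case using Suc by simp
  qed simp
  then show ?thesis using of_nat_eq_iff by blast
qed

text \<open>An exponential moment computed day by day. The state \<open>\<sigma>\<close> carries
  what the past determines, such as the day and the memory; as the bound for one day is uniform in
  the state and in \<open>x\<close>, the days multiply as if they were independent.\<close>

lemma sum_inputs_le_power:
  fixes \<Phi> :: "'s \<Rightarrow> 'p::finite expert_input \<Rightarrow> real"
  assumes Nil: "\<And>\<sigma>. \<Phi> \<sigma> [] = 1"
    and Cons: "\<And>\<sigma> x y s. \<Phi> \<sigma> ((x, y) # s) = \<phi> \<sigma> x y * \<Phi> (\<nu> \<sigma> x y) s"
    and nonneg: "\<And>\<sigma> x y. 0 \<le> \<phi> \<sigma> x y"
    and day: "\<And>\<sigma> x. x \<in> predictions n \<Longrightarrow> (\<Sum>y\<in>UNIV. \<phi> \<sigma> x y) \<le> real CARD('p) * K"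
    and K: "0 \<le> K"
  shows "(\<Sum>s\<in>inputs n T. \<Phi> \<sigma> s) \<le> (real CARD('p) ^ (n + 1) * K) ^ T"
proof (induction T arbitrary: \<sigma>)
  case 0
  then show ?case by (simp add: Nil)
next
  case (Suc T)
  let ?q = "real CARD('p)"
  have "(\<Sum>s\<in>inputs n (Suc T). \<Phi> \<sigma> s) =
      (\<Sum>x\<in>predictions n. \<Sum>y\<in>UNIV. \<phi> \<sigma> x y * (\<Sum>s\<in>inputs n T. \<Phi> (\<nu> \<sigma> x y) s))"
    by (simp add: sum_inputs_Suc Cons sum_distrib_left)
  also have "\<dots> \<le> (\<Sum>x\<in>(predictions n :: 'p list set). \<Sum>y\<in>UNIV. \<phi> \<sigma> x y * (?q ^ (n + 1) * K) ^ T)"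
    by (intro sum_mono mult_left_mono Suc.IH nonneg)
  also have "\<dots> \<le> (\<Sum>x\<in>(predictions n :: 'p list set). ?q * K * (?q ^ (n + 1) * K) ^ T)"
  proof (rule sum_mono)
    fix x :: "'p list" assume x: "x \<in> predictions n"
    have "0 \<le> (?q ^ (n + 1) * K) ^ T" using K by simp
    from mult_right_mono[OF day[OF x, of \<sigma>] this]
    show "(\<Sum>y\<in>UNIV. \<phi> \<sigma> x y * (?q ^ (n + 1) * K) ^ T) \<le> ?q * K * (?q ^ (n + 1) * K) ^ T"
      by (simp add: sum_distrib_right)
  qed
  also have "\<dots> = (?q ^ (n + 1) * K) ^ Suc T" by (simp add: card_predictions)
  finally show ?case .
qed

section \<open>One day of a planted expert\<close>

text \<open>The graph of \<open>exp\<close> lies above its tangent at the mean \<open>u\<close>, and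
  the deviations from \<open>u\<close> sum to zero.\<close>

lemma jensen_exp_sum:
  fixes g :: "'a \<Rightarrow> real"
  assumes "finite X" "X \<noteq> {}"
  shows "real (card X) * exp ((\<Sum>x\<in>X. g x) / real (card X)) \<le> (\<Sum>x\<in>X. exp (g x))"
proof -
  define u where "u = (\<Sum>x\<in>X. g x) / real (card X)"
  have card: "real (card X) > 0" using assms by (simp add: card_gt_0_iff)
  have "real (card X) * exp u = (\<Sum>x\<in>X. exp u * (1 + (g x - u)))"
    using card by (simp add: sum_distrib_left[symmetric] sum.distrib sum_subtractf u_def)
  also have "\<dots> \<le> (\<Sum>x\<in>X. exp (g x))"
  proof (rule sum_mono)
    fix x
    have "exp u * (1 + (g x - u)) \<le> exp u * exp (g x - u)"
      by (intro mult_left_mono exp_ge_add_one_self) simp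
    then show "exp u * (1 + (g x - u)) \<le> exp (g x)" by (simp add: exp_add[symmetric])
  qed
  finally show ?thesis by (simp add: u_def)
qed

text \<open>
  Exponential tilting: \<open>exp (- \<eta> * card {i \<in> B. x ! i = b})\<close> is large on average over \<open>X\<close> by Jensen's
  inequality, whereas its sum over all \<open>x\<close> factorizes over the coordinates.
\<close>

lemma card_sparse_coordinates:
  fixes X :: "'p::finite list set" and b :: 'p
  assumes q2: "2 \<le> CARD('p)" and X: "X \<subseteq> predictions n" "X \<noteq> {}" and \<eta>: "0 < \<eta>" "\<eta> \<le> 1"
  defines "B \<equiv> {i. i < n \<and> real (card {x\<in>X. x ! i = b}) < (1 / real CARD('p) - \<eta>) * real (card X)}"
  shows "real (card X) / real CARD('p) ^ n \<le> exp (- real (card B) * \<eta>\<^sup>2 / 2)"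
proof -
  define q where "q = real CARD('p)"
  have q: "2 \<le> q" using q2 unfolding q_def by simp
  define k where "k = real (card B)"
  have finX: "finite X" using X finite_subset finite_predictions by blast
  have card: "real (card X) > 0" using X finX by (simp add: card_gt_0_iff)
  have finB: "finite B" by (simp add: B_def)
  have Bn: "B \<subseteq> {..<n}" by (auto simp: B_def)
  \<comment> \<open>The exponent of the tilt, restricted to the sparse coordinates \<open>B\<close>.
    Sparsity keeps its mean over \<open>X\<close> high.\<close>
  define g where "g x = (\<Sum>i\<in>B. - \<eta> * of_bool (x ! i = b))" for x :: "'p list"
  have "(\<Sum>x\<in>X. g x) = (\<Sum>i\<in>B. - \<eta> * real (card {x\<in>X. x ! i = b}))"
  proof -
    have "(\<Sum>x\<in>X. g x) = (\<Sum>i\<in>B. \<Sum>x\<in>X. - \<eta> * of_bool (x ! i = b))"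
      unfolding g_def by (rule sum.swap)
    also have "\<dots> = (\<Sum>i\<in>B. - \<eta> * real (card {x\<in>X. x ! i = b}))"
      using finX by (intro sum.cong refl) (simp add: sum_distrib_left[symmetric] sum_negf Int_def)
    finally show ?thesis .
  qed
  also have "\<dots> \<ge> (\<Sum>i\<in>B. - \<eta> * ((1 / q - \<eta>) * real (card X)))"
    using \<eta> by (intro sum_mono) (auto simp: B_def q_def intro!: mult_left_mono)
  finally have avg: "(\<Sum>x\<in>X. g x) / real (card X) \<ge> - \<eta> * k * (1 / q - \<eta>)"
    using card by (simp add: k_def field_simps)
  have "real (card X) * exp (- \<eta> * k * (1 / q - \<eta>)) \<le> real (card X) * exp ((\<Sum>x\<in>X. g x) / real (card X))"
    using avg by (intro mult_left_mono) auto
  also have "\<dots> \<le> (\<Sum>x\<in>X. exp (g x))" by (rule jensen_exp_sum[OF finX X(2)])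
  also have "\<dots> \<le> (\<Sum>x\<in>predictions n. exp (g x))" by (rule sum_mono2) (use X in auto)
  also have "\<dots> = (\<Sum>x\<in>predictions n. \<Prod>i<n. if i \<in> B \<and> x ! i = b then exp (- \<eta>) else 1)"
  proof (rule sum.cong[OF refl])
    fix x :: "'p list"
    have "exp (g x) = (\<Prod>i\<in>B. if x ! i = b then exp (- \<eta>) else 1)"
      unfolding g_def exp_sum[OF finB] by (intro prod.cong) auto
    also have "\<dots> = (\<Prod>i<n. if i \<in> B \<and> x ! i = b then exp (- \<eta>) else 1)"
      by (rule prod.mono_neutral_cong_left) (use Bn in auto)
    finally show "exp (g x) = (\<Prod>i<n. if i \<in> B \<and> x ! i = b then exp (- \<eta>) else 1)" .
  qed
  also have "\<dots> = (\<Prod>i<n. \<Sum>c\<in>UNIV. if i \<in> B \<and> c = b then exp (- \<eta>) else 1)"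
    by (rule sum_predictions_prod)
  also have "\<dots> = (\<Prod>i<n. q * (if i \<in> B then 1 + (exp (- \<eta>) - 1) / q else 1))"
  proof (rule prod.cong[OF refl])
    fix i
    have "(\<Sum>c\<in>UNIV. if i \<in> B \<and> c = b then exp (- \<eta>) else 1) =
       (\<Sum>c\<in>UNIV. if b = c then (if i \<in> B then exp (- \<eta>) else 1) else 1)"
      by (intro sum.cong) auto
    also have "\<dots> = (if i \<in> B then exp (- \<eta>) else 1) + (q - 1) * 1"
      unfolding q_def by (rule sum_if_eq)
    also have "\<dots> = q * (if i \<in> B then 1 + (exp (- \<eta>) - 1) / q else 1)"
      using q by (simp add: field_simps)
    finally show "(\<Sum>c\<in>UNIV. if i \<in> B \<and> c = b then exp (- \<eta>) else 1) =
        q * (if i \<in> B then 1 + (exp (- \<eta>) - 1) / q else 1)" .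
  qed
  also have "\<dots> = q ^ n * (1 + (exp (- \<eta>) - 1) / q) ^ card B"
    using Bn by (simp add: prod.distrib prod.If_cases inf.absorb2)
  \<comment> \<open>In the full space \<open>b\<close> has frequency exactly \<open>1 / q\<close> in
    every coordinate, so each element of \<open>B\<close> contributes at most
    \<open>exp ((\<eta>\<^sup>2 - \<eta>) / q)\<close>.\<close>
  also have "\<dots> \<le> q ^ n * exp (k * ((\<eta>\<^sup>2 - \<eta>) / q))"
  proof -
    have "exp (- \<eta>) \<le> 1 - \<eta> + \<eta>\<^sup>2" using exp_le_quadratic[of "- \<eta>"] \<eta> by simp
    then have "1 + (exp (- \<eta>) - 1) / q \<le> 1 + (\<eta>\<^sup>2 - \<eta>) / q"
      using q by (simp add: divide_right_mono)
    also have "\<dots> \<le> exp ((\<eta>\<^sup>2 - \<eta>) / q)" by (rule exp_ge_add_one_self)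
    finally have *: "1 + (exp (- \<eta>) - 1) / q \<le> exp ((\<eta>\<^sup>2 - \<eta>) / q)" .
    have "0 \<le> 1 + (exp (- \<eta>) - 1) / q"
    proof -
      have "1 \<le> q + exp (- \<eta>)" using q exp_gt_zero[of "- \<eta>"] by linarith
      then show ?thesis using q by (simp add: field_simps)
    qed
    then have "(1 + (exp (- \<eta>) - 1) / q) ^ card B \<le> exp ((\<eta>\<^sup>2 - \<eta>) / q) ^ card B"
      by (intro power_mono *)
    then show ?thesis using q by (simp add: exp_of_nat_mult[symmetric] k_def)
  qed
  finally have "real (card X) * exp (- \<eta> * k * (1 / q - \<eta>)) \<le> q ^ n * exp (k * ((\<eta>\<^sup>2 - \<eta>) / q))" .
  then have "real (card X) / q ^ n \<le> exp (k * ((\<eta>\<^sup>2 - \<eta>) / q)) / exp (- \<eta> * k * (1 / q - \<eta>))"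
    using q by (simp add: field_simps)
  also have "\<dots> = exp (k * ((\<eta>\<^sup>2 - \<eta>) / q) + \<eta> * k * (1 / q - \<eta>))"
    by (simp add: exp_diff[symmetric])
  also have "k * ((\<eta>\<^sup>2 - \<eta>) / q) + \<eta> * k * (1 / q - \<eta>) = k * \<eta>\<^sup>2 / q - k * \<eta>\<^sup>2"
    by (simp add: algebra_simps diff_divide_distrib power2_eq_square)
  \<comment> \<open>Sparsity contributes \<open>- k * \<eta>\<^sup>2\<close> to the exponent; the
    second-order error \<open>k * \<eta>\<^sup>2 / q\<close> cancels at most half of it because
    \<open>2 \<le> q\<close>.\<close>
  also have "exp (k * \<eta>\<^sup>2 / q - k * \<eta>\<^sup>2) \<le> exp (- k * \<eta>\<^sup>2 / 2)"
  proof -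
    have "k * \<eta>\<^sup>2 / q \<le> k * \<eta>\<^sup>2 / 2"
      using q by (intro divide_left_mono) (auto simp: k_def)
    then have "k * \<eta>\<^sup>2 / q - k * \<eta>\<^sup>2 \<le> - k * \<eta>\<^sup>2 / 2" by (simp del: le_divide_eq_numeral1 divide_le_eq_numeral1)
    then show ?thesis by (simp only: exp_le_cancel_iff)
  qed
  finally show ?thesis by (simp add: q_def k_def)
qed

text \<open>Normalized so that its sum over all \<open>y\<close> is \<open>CARD('p)\<close>.\<close>

definition density :: "real \<Rightarrow> 'p::finite \<Rightarrow> 'p \<Rightarrow> real" where
  "density \<delta> b y = (if b = y then real CARD('p) - (real CARD('p) - 1) * \<delta> else \<delta>)"

lemma density_nonneg:
  assumes "0 \<le> \<delta>" "\<delta> \<le> 1"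
  shows "0 \<le> density \<delta> (b :: 'p::finite) y"
proof -
  have q: "1 \<le> real CARD('p)" using one_le_card_finite[where 'a='p] by linarith
  have "(real CARD('p) - 1) * \<delta> \<le> (real CARD('p) - 1) * 1"
    using q assms by (intro mult_left_mono) auto
  then show ?thesis using assms by (simp add: density_def)
qed

text \<open>A coordinate in which \<open>y\<close> has frequency at least
  \<open>1 / q - \<eta>\<close> loses only the factor \<open>1 - q * \<eta>\<close>; a sparse one
  may lose a further \<open>\<delta>\<close>. The number of sparse coordinates is logarithmic in the
  density of \<open>X\<close>, and the exponent of \<open>powr\<close> is chosen to turn that bound
  into \<open>\<delta> ^ card B\<close>. A power of the density is used because it multiplies over
  days.\<close>

lemma prod_density_day_ge:
  fixes X :: "'p::finite list set" and y :: 'p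
  assumes q2: "2 \<le> CARD('p)" and X: "X \<subseteq> predictions n" and n: "0 < n"
    and \<eta>: "0 < \<eta>" "real CARD('p) * \<eta> \<le> 1" and \<delta>: "0 < \<delta>" "\<delta> \<le> 1"
  shows "(real (card X) * (1 - real CARD('p) * \<eta>)) ^ n *
      (real (card X) / real CARD('p) ^ n) powr (2 * ln (1 / \<delta>) / \<eta>\<^sup>2)
    \<le> (\<Prod>i<n. \<Sum>x\<in>X. density \<delta> (x ! i) y)"
proof (cases "X = {}")
  case True
  then show ?thesis using n by simp
next
  case False
  define q where "q = real CARD('p)"
  have q: "2 \<le> q" using q2 unfolding q_def by simp
  have \<eta>1: "\<eta> \<le> 1" 
  proof -
    have "1 * \<eta> \<le> q * \<eta>" using q \<eta> by (intro mult_right_mono) auto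
    then show ?thesis using \<eta>(2) unfolding q_def by linarith
  qed
  have finX: "finite X" using X finite_subset finite_predictions by blast
  have card: "real (card X) > 0" using False finX by (simp add: card_gt_0_iff)
  define B where "B = {i. i < n \<and> real (card {x\<in>X. x ! i = y}) < (1 / real CARD('p) - \<eta>) * real (card X)}"
  define N where "N = real (card X)"
  have N: "N > 0" using card by (simp add: N_def)
  have Bn: "B \<subseteq> {..<n}" by (auto simp: B_def)
  define P where "P = N / q ^ n"
  have P: "0 < P" using N q by (simp add: P_def)
  have PB: "P \<le> exp (- real (card B) * \<eta>\<^sup>2 / 2)"
    using card_sparse_coordinates[OF q2 X False \<eta>(1) \<eta>1, of y] by (simp add: P_def N_def q_def B_def)
  have "P powr (2 * ln (1 / \<delta>) / \<eta>\<^sup>2) \<le> exp (- real (card B) * \<eta>\<^sup>2 / 2) powr (2 * ln (1 / \<delta>) / \<eta>\<^sup>2)"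
    using P PB \<delta> by (intro powr_mono2) auto
  also have "\<dots> = exp (- real (card B) * ln (1 / \<delta>))"
    using \<eta> by (simp add: powr_def)
  also have "\<dots> = \<delta> ^ card B"
    using \<delta> by (simp add: ln_div exp_of_nat_mult)
  finally have Pd: "P powr (2 * ln (1 / \<delta>) / \<eta>\<^sup>2) \<le> \<delta> ^ card B" .
  have each: "N * (1 - q * \<eta>) * (if i \<in> B then \<delta> else 1) \<le> (\<Sum>x\<in>X. density \<delta> (x ! i) y)" if "i < n" for i
  proof -
    define c where "c = real (card {x\<in>X. x ! i = y})"
    \<comment> \<open>Planting is a mixture: weight \<open>\<delta>\<close> on the uniform
      distribution and \<open>1 - \<delta>\<close> on the outcome that agrees with the
      expert.\<close>
    have "(\<Sum>x\<in>X. density \<delta> (x ! i) y) = (\<Sum>x\<in>X. \<delta> + (q - q * \<delta>) * of_bool (x ! i = y))"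
      by (intro sum.cong) (auto simp: density_def q_def algebra_simps)
    also have "\<dots> = N * \<delta> + (q - q * \<delta>) * c"
      using finX by (simp add: sum.distrib sum_distrib_left[symmetric] N_def c_def Int_def)
    finally have eq: "(\<Sum>x\<in>X. density \<delta> (x ! i) y) = N * \<delta> + q * (1 - \<delta>) * c"
      by (simp add: algebra_simps)
    show ?thesis
    proof (cases "i \<in> B")
      case True
      have "N * (1 - q * \<eta>) * \<delta> \<le> N * 1 * \<delta>"
        using N q \<eta> \<delta> by (intro mult_right_mono mult_left_mono) auto
      moreover have "0 \<le> q * (1 - \<delta>) * c" using q \<delta> by (simp add: c_def)
      ultimately show ?thesis using True eq by simp
    next
      case F: False
      then have "(1 / q - \<eta>) * N \<le> c" using that by (auto simp: B_def c_def N_def q_def)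
      then have "q * (1 - \<delta>) * ((1 / q - \<eta>) * N) \<le> q * (1 - \<delta>) * c"
        using q \<delta> by (intro mult_left_mono) auto
      moreover have "q * (1 - \<delta>) * ((1 / q - \<eta>) * N) = (1 - \<delta>) * (1 - q * \<eta>) * N"
        using q by (simp add: field_simps)
      moreover have "N * (1 - q * \<eta>) = N * (1 - q * \<eta>) * \<delta> + (1 - \<delta>) * (1 - q * \<eta>) * N"
        by (simp add: algebra_simps)
      moreover have "N * (1 - q * \<eta>) * \<delta> \<le> N * 1 * \<delta>"
        using N q \<eta> \<delta> by (intro mult_right_mono mult_left_mono) auto
      ultimately show ?thesis using F eq by simp
    qed
  qed
  have "(N * (1 - q * \<eta>)) ^ n * P powr (2 * ln (1 / \<delta>) / \<eta>\<^sup>2) \<le> (N * (1 - q * \<eta>)) ^ n * \<delta> ^ card B"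
    using N \<eta> by (intro mult_left_mono Pd) (auto simp: q_def)
  also have "\<dots> = (\<Prod>i<n. N * (1 - q * \<eta>) * (if i \<in> B then \<delta> else 1))"
    using Bn by (simp add: prod.distrib prod.If_cases inf.absorb2)
  also have "\<dots> \<le> (\<Prod>i<n. \<Sum>x\<in>X. density \<delta> (x ! i) y)"
    using each N \<eta> \<delta> by (intro prod_mono) (auto simp: q_def)
  finally show ?thesis by (simp add: N_def P_def q_def)
qed

section \<open>Transcripts and rectangles\<close>

text \<open>The likelihood ratio between the distribution with planted expert \<open>i\<close> and the uniform one.\<close>

fun weight :: "real \<Rightarrow> nat \<Rightarrow> 'p::finite expert_input \<Rightarrow> real" where
  "weight \<delta> i [] = 1"
| "weight \<delta> i ((x, y) # s) = density \<delta> (x ! i) y * weight \<delta> i s"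

lemma weight_nonneg:
  assumes "0 \<le> \<delta>" "\<delta> \<le> 1"
  shows "0 \<le> weight \<delta> i s"
  by (induction s) (auto simp: density_nonneg[OF assms])

text \<open>The outcomes determine the mistakes on unanimous days and the Boolean flags those of the
  algorithm. The memory contents are recorded as well to decouple the prediction vectors of
  different days.\<close>

fun transcript :: "'p det_alg \<Rightarrow> nat \<Rightarrow> bool list \<Rightarrow> 'p expert_input \<Rightarrow> ('p \<times> bool list \<times> bool) list" where
  "transcript A t m [] = []"
| "transcript A t m ((x, y) # s) =
     (y, update A t m x y, predict A t m x = y) # transcript A (Suc t) (update A t m x y) s"

lemma mistakes_from_transcript:
  "mistakes_from A t m s = length (filter (\<lambda>(y, m, correct). \<not> correct) (transcript A t m s))"
  by (induction A t m s rule: mistakes_from.induct) auto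

lemma map_fst_transcript: "map fst (transcript A t m s) = map snd s"
  by (induction A t m s rule: transcript.induct) auto

definition cell :: "nat \<Rightarrow> 'p::finite det_alg \<Rightarrow> nat \<Rightarrow> bool list \<Rightarrow> nat \<Rightarrow> ('p \<times> bool list \<times> bool) list \<Rightarrow> 'p expert_input set" where
  "cell n A t m T \<tau> = {s \<in> inputs n T. transcript A t m s = \<tau>}"

lemma finite_cell [simp]: "finite (cell n A t m T \<tau>)"
  by (simp add: cell_def)

text \<open>The rectangle property: once the memory after the first day is prescribed, the later
  days constrain the first prediction vector no further.\<close>

lemma cell_Suc_Cons:
  "cell n A t m (Suc T) ((y, m', c) # \<tau>) =
    (\<lambda>(x, s). (x, y) # s) ` ({x \<in> predictions n. update A t m x y = m' \<and> (predict A t m x = y) = c} \<times> cell n A (Suc t) m' T \<tau>)"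
  unfolding cell_def inputs_Suc by (auto simp: image_iff)

text \<open>The cell, the weight and the bound for one day are all multiplicative over days, so the
  estimates for the single factors of the rectangle are multiplied.\<close>

lemma prod_weight_cell_ge:
  fixes A :: "'p::finite det_alg"
  assumes q2: "2 \<le> CARD('p)" and n: "0 < n"
    and \<eta>: "0 < \<eta>" "real CARD('p) * \<eta> \<le> 1" and \<delta>: "0 < \<delta>" "\<delta> \<le> 1"
  shows "(real (card (cell n A t m T \<tau>)) * (1 - real CARD('p) * \<eta>) ^ T) ^ n *
      (real (card (cell n A t m T \<tau>)) / (real CARD('p) ^ n) ^ T) powr (2 * ln (1 / \<delta>) / \<eta>\<^sup>2)
    \<le> (\<Prod>i<n. \<Sum>s\<in>cell n A t m T \<tau>. weight \<delta> i s)"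
proof (induction T arbitrary: t m \<tau>)
  case 0
  show ?case
  proof (cases "\<tau> = []")
    case True
    then have "cell n A t m 0 \<tau> = {[]}" by (auto simp: cell_def)
    then show ?thesis by simp
  next
    case False
    then have "cell n A t m 0 \<tau> = {}" by (auto simp: cell_def)
    then show ?thesis using n by simp
  qed
next
  case (Suc T)
  let ?C = "2 * ln (1 / \<delta>) / \<eta>\<^sup>2"
  let ?q = "real CARD('p)"
  show ?case
  proof (cases \<tau>)
    case Nil
    then have "cell n A t m (Suc T) \<tau> = {}" by (auto simp: cell_def inputs_Suc)
    then show ?thesis using n by simp
  next
    case (Cons d \<tau>')
    obtain y m' c where d: "d = (y, m', c)" by (cases d) auto
    define X where "X = {x \<in> predictions n. update A t m x y = m' \<and> (predict A t m x = y) = c}"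
    define E where "E = cell n A (Suc t) m' T \<tau>'"
    have XE: "cell n A t m (Suc T) \<tau> = (\<lambda>(x, s). (x, y) # s) ` (X \<times> E)"
      unfolding Cons d cell_Suc_Cons X_def E_def ..
    have inj: "inj_on (\<lambda>(x, s). (x, y) # s) (X \<times> E)" by (auto simp: inj_on_def)
    have card: "card (cell n A t m (Suc T) \<tau>) = card X * card E"
      unfolding XE card_image[OF inj] by (simp add: card_cartesian_product)
    have sum: "(\<Sum>s\<in>cell n A t m (Suc T) \<tau>. weight \<delta> i s) =
        (\<Sum>x\<in>X. density \<delta> (x ! i) y) * (\<Sum>s\<in>E. weight \<delta> i s)" for i
      unfolding XE sum.reindex[OF inj]
      by (simp add: case_prod_unfold sum_product sum.cartesian_product)
    have X: "X \<subseteq> predictions n" by (auto simp: X_def)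
    let ?u = "(real (card X) * (1 - ?q * \<eta>)) ^ n * (real (card X) / ?q ^ n) powr ?C"
    let ?v = "(real (card E) * (1 - ?q * \<eta>) ^ T) ^ n * (real (card E) / (?q ^ n) ^ T) powr ?C"
    have "(real (card (cell n A t m (Suc T) \<tau>)) * (1 - ?q * \<eta>) ^ Suc T) ^ n *
      (real (card (cell n A t m (Suc T) \<tau>)) / (?q ^ n) ^ Suc T) powr ?C = ?u * ?v"
    proof -
      have "real (card X * card E) / (?q ^ n) ^ Suc T = (real (card X) / ?q ^ n) * (real (card E) / (?q ^ n) ^ T)"
        by simp
      then show ?thesis
        unfolding card by (simp only: powr_mult) (simp add: power_mult_distrib mult_ac)
    qed
    also have "\<dots> \<le> (\<Prod>i<n. \<Sum>x\<in>X. density \<delta> (x ! i) y) * (\<Prod>i<n. \<Sum>s\<in>E. weight \<delta> i s)"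
    proof (rule mult_mono[OF prod_density_day_ge[OF q2 X n \<eta> \<delta>] Suc.IH[of "Suc t" m' \<tau>', folded E_def]])
      show "0 \<le> (\<Prod>i<n. \<Sum>x\<in>X. density \<delta> (x ! i) y)"
        using \<delta> by (intro prod_nonneg sum_nonneg ballI density_nonneg) auto
      show "0 \<le> ?v" using \<eta> by simp
    qed
    also have "\<dots> = (\<Prod>i<n. \<Sum>s\<in>cell n A t m (Suc T) \<tau>. weight \<delta> i s)"
      by (simp add: sum prod.distrib)
    finally show ?thesis .
  qed
qed

text \<open>AM-GM over the experts turns the product bound into a bound for the sum. Its
  \<open>n\<close>-th root divides the exponent of the density by \<open>n\<close>, so a cell of
  density at least \<open>(1 / 2) ^ ((S + 2) * T)\<close> costs a factor per day that is close to 1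
  when \<open>S / n\<close> and \<open>\<eta>\<close> are small.\<close>

lemma sum_weight_cell_ge:
  fixes A :: "'p::finite det_alg"
  assumes q2: "2 \<le> CARD('p)" and n: "0 < n"
    and \<eta>: "0 < \<eta>" "real CARD('p) * \<eta> \<le> 1" and \<delta>: "0 < \<delta>" "\<delta> \<le> 1"
    and typical: "(real CARD('p) ^ n) ^ T * (1 / 2) ^ ((S + 2) * T) \<le> real (card (cell n A t m T \<tau>))"
  shows "real n * ((1 - real CARD('p) * \<eta>) * (1 / 2) powr (2 * ln (1 / \<delta>) / \<eta>\<^sup>2 * real (S + 2) / real n)) ^ T *
      real (card (cell n A t m T \<tau>))
    \<le> (\<Sum>i<n. \<Sum>s\<in>cell n A t m T \<tau>. weight \<delta> i s)"
proof -
  let ?C = "2 * ln (1 / \<delta>) / \<eta>\<^sup>2"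
  define q where "q = real CARD('p)"
  have q: "2 \<le> q" using q2 unfolding q_def by simp
  define N where "N = real (card (cell n A t m T \<tau>))"
  define a where "a i = (\<Sum>s\<in>cell n A t m T \<tau>. weight \<delta> i s)" for i
  have a: "0 \<le> a i" for i using \<delta> by (auto simp: a_def intro!: sum_nonneg weight_nonneg)
  have C: "0 \<le> ?C" using \<delta> by simp
  have N0: "0 \<le> N" by (simp add: N_def)
  have "N * (1 - q * \<eta>) ^ T * ((1 / 2) powr (?C * real (S + 2) / real n)) ^ T
     = ((N * (1 - q * \<eta>) ^ T) ^ n * ((1 / 2) ^ ((S + 2) * T)) powr ?C) powr (1 / real n)"
  proof -
    have "(z ^ n) powr (1 / real n) = z" if "0 \<le> z" for z :: real
      using that n by (cases "z = 0") (auto simp: powr_realpow[symmetric] powr_powr)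
    moreover have "0 \<le> N * (1 - q * \<eta>) ^ T" using \<eta> N0 by (simp add: q_def)
    ultimately have 1: "((N * (1 - q * \<eta>) ^ T) ^ n) powr (1 / real n) = N * (1 - q * \<eta>) ^ T"
      by blast
    have 2: "(((1 / 2 :: real) ^ ((S + 2) * T)) powr ?C) powr (1 / real n) = ((1 / 2) powr (?C * real (S + 2) / real n)) ^ T"
    proof -
      have "((h ^ k) powr ?C) powr (1 / real n) = (h powr (?C * r / real n)) ^ T"
        if "0 < h" "real k = r * real T" for h r :: real and k
        using that by (simp add: powr_realpow[symmetric] powr_powr mult_ac)
      from this[of "1 / 2" "(S + 2) * T" "real (S + 2)"] show ?thesis by (simp only: of_nat_mult)
    qed
    show ?thesis unfolding powr_mult 1 2 by simp
  qed
  also have "\<dots> \<le> ((N * (1 - q * \<eta>) ^ T) ^ n * (N / (q ^ n) ^ T) powr ?C) powr (1 / real n)"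
  proof (intro powr_mono2 mult_left_mono)
    show "(1 / 2) ^ ((S + 2) * T) \<le> N / (q ^ n) ^ T"
      using typical q by (simp add: N_def q_def field_simps)
  qed (use C N0 \<eta> in \<open>auto simp: q_def\<close>)
  also have "\<dots> \<le> (\<Prod>i<n. a i) powr (1 / real n)"
    using prod_weight_cell_ge[OF q2 n \<eta> \<delta>, of A t m T \<tau>] N0 \<eta>
    by (intro powr_mono2) (auto simp: N_def q_def a_def)
  also have "\<dots> \<le> (\<Sum>i<n. a i) / real n"
    using arith_geom_mean[of "{..<n}" a] a n by (auto simp: sum_divide_distrib)
  finally have "real n * (N * (1 - q * \<eta>) ^ T * ((1 / 2) powr (?C * real (S + 2) / real n)) ^ T) \<le> (\<Sum>i<n. a i)"
    using n by (simp only: pos_le_divide_eq of_nat_0_less_iff mult.commute)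
  then show ?thesis
    by (simp only: N_def[symmetric] a_def[symmetric] q_def[symmetric] power_mult_distrib mult_ac)
qed


section \<open>Counting transcripts and discarding the atypical ones\<close>

definition transcripts :: "nat \<Rightarrow> nat \<Rightarrow> ('p::finite \<times> bool list \<times> bool) list set" where
  "transcripts S T = {\<tau>. set \<tau> \<subseteq> UNIV \<times> {m. length m = S} \<times> UNIV \<and> length \<tau> = T}"

lemma finite_card_transcripts:
  "finite (transcripts S T :: ('p::finite \<times> bool list \<times> bool) list set)"
  "card (transcripts S T :: ('p::finite \<times> bool list \<times> bool) list set) = (CARD('p) * 2 ^ (S + 1)) ^ T"
proof -
  have m: "finite {m :: bool list. length m = S}" "card {m :: bool list. length m = S} = 2 ^ S"
    using finite_lists_length_eq[of "UNIV :: bool set" S] card_lists_length_eq[of "UNIV :: bool set" S]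
    by auto
  let ?U = "(UNIV :: 'p set) \<times> {m :: bool list. length m = S} \<times> (UNIV :: bool set)"
  have "finite ?U" "card ?U = CARD('p) * 2 ^ (S + 1)" using m by (auto simp: card_cartesian_product)
  then show "finite (transcripts S T :: ('p \<times> bool list \<times> bool) list set)"
    "card (transcripts S T :: ('p \<times> bool list \<times> bool) list set) = (CARD('p) * 2 ^ (S + 1)) ^ T"
    using finite_lists_length_eq[of ?U T] card_lists_length_eq[of ?U T] by (auto simp: transcripts_def)
qed

lemma transcript_in_transcripts:
  assumes "\<forall>t m x y. length m = S \<and> length x = n \<longrightarrow> length (update A t m x y) = S"
  shows "length m = S \<Longrightarrow> s \<in> inputs n T \<Longrightarrow> transcript A t m s \<in> transcripts S T"
proof (induction T arbitrary: t m s)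
  case (Suc T)
  from Suc.prems(2) obtain x y s' where s: "s = (x, y) # s'" "length x = n" "s' \<in> inputs n T"
    by (auto simp: inputs_Suc predictions_def)
  have "length (update A t m x y) = S" using assms Suc.prems(1) s(2) by blast
  with Suc.IH[OF this s(3), of "Suc t"] show ?case by (auto simp: s(1) transcripts_def)
qed (simp add: transcripts_def)

text \<open>
  There are at most \<open>(q * 2 ^ (S + 1)) ^ T\<close> transcripts, so those whose cell is smaller than a fraction
  \<open>2 ^ (- (S + 2) T)\<close> of \<open>(q ^ n) ^ T\<close> together carry at most the fraction \<open>2 ^ (- T)\<close> subtracted below.
\<close>

lemma sum_weight_ge:
  fixes A :: "'p::finite det_alg"
  assumes q2: "2 \<le> CARD('p)" and n: "0 < n"
    and \<eta>: "0 < \<eta>" "real CARD('p) * \<eta> \<le> 1" and \<delta>: "0 < \<delta>" "\<delta> \<le> 1"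
    and upd: "\<forall>t m x y. length m = S \<and> length x = n \<longrightarrow> length (update A t m x y) = S"
    and m: "length m = S"
  shows "real n * ((1 - real CARD('p) * \<eta>) * (1 / 2) powr (2 * ln (1 / \<delta>) / \<eta>\<^sup>2 * real (S + 2) / real n)) ^ T *
      (real (card {s \<in> inputs n T. transcript A t m s \<in> B}) - (real CARD('p) ^ (n + 1)) ^ T * (1 / 2) ^ T)
    \<le> (\<Sum>i<n. \<Sum>s \<in> {s \<in> inputs n T. transcript A t m s \<in> B}. weight \<delta> i s)"
proof -
  define q where "q = real CARD('p)"
  have q: "2 \<le> q" using q2 unfolding q_def by simp
  define \<beta> where "\<beta> = (1 - real CARD('p) * \<eta>) * (1 / 2) powr (2 * ln (1 / \<delta>) / \<eta>\<^sup>2 * real (S + 2) / real n)"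
  have \<beta>: "0 \<le> \<beta>" using \<eta> by (simp add: \<beta>_def)
  define thr where "thr = (q ^ n) ^ T * (1 / 2) ^ ((S + 2) * T)"
  define N where "N \<tau> = real (card (cell n A t m T \<tau>))" for \<tau>
  define R where "R = (transcripts S T :: ('p \<times> bool list \<times> bool) list set)"
  define G where "G = {\<tau> \<in> R. thr \<le> N \<tau>}"
  have finR: "finite R" by (simp add: R_def finite_card_transcripts)
  then have finG: "finite G" by (simp add: G_def)
  \<comment> \<open>Cells of different transcripts are disjoint, and every transcript that occurs
    lies in \<open>R\<close>.\<close>
  have split: "(\<Sum>s \<in> {s \<in> inputs n T. transcript A t m s \<in> B}. f s) = (\<Sum>\<tau>\<in>R \<inter> B. \<Sum>s\<in>cell n A t m T \<tau>. f s)"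
    for f :: "'p expert_input \<Rightarrow> real"
  proof -
    have "(\<Sum>\<tau>\<in>R \<inter> B. \<Sum>s\<in>cell n A t m T \<tau>. f s) = sum f (\<Union>\<tau>\<in>R \<inter> B. cell n A t m T \<tau>)"
      by (rule sum.UNION_disjoint[symmetric]) (use finR in \<open>auto simp: cell_def\<close>)
    also have "(\<Union>\<tau>\<in>R \<inter> B. cell n A t m T \<tau>) = {s \<in> inputs n T. transcript A t m s \<in> B}"
      using transcript_in_transcripts[OF upd m, of _ T t] unfolding cell_def R_def by blast
    finally show ?thesis ..
  qed
  have "real (card {s \<in> inputs n T. transcript A t m s \<in> B}) = (\<Sum>\<tau>\<in>R \<inter> B. N \<tau>)"
    using split[of "\<lambda>_. 1"] by (simp add: N_def)
  also have "\<dots> = (\<Sum>\<tau>\<in>G \<inter> B. N \<tau>) + (\<Sum>\<tau>\<in>(R - G) \<inter> B. N \<tau>)"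
  proof -
    have "R \<inter> B = (G \<inter> B) \<union> ((R - G) \<inter> B)" by (auto simp: G_def)
    then show ?thesis using finR finG by (simp only:) (rule sum.union_disjoint, auto)
  qed
  also have "(\<Sum>\<tau>\<in>(R - G) \<inter> B. N \<tau>) \<le> (\<Sum>\<tau>\<in>R. thr)"
  proof -
    have "(\<Sum>\<tau>\<in>(R - G) \<inter> B. N \<tau>) \<le> (\<Sum>\<tau>\<in>(R - G) \<inter> B. thr)"
      by (rule sum_mono) (auto simp: G_def)
    also have "\<dots> \<le> (\<Sum>\<tau>\<in>R. thr)"
      by (rule sum_mono2) (use finR q in \<open>auto simp: thr_def\<close>)
    finally show ?thesis .
  qed
  also have "(\<Sum>\<tau>\<in>R. thr) = (q ^ (n + 1)) ^ T * (1 / 2) ^ T"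
  proof -
    \<comment> \<open>Per day there are \<open>q * 2 ^ (S + 1)\<close> possible records, the last
      factor 2 being the correctness flag; the exponent \<open>S + 2\<close> in \<open>thr\<close>
      leaves one further factor \<open>1 / 2\<close>.\<close>
    have "q * 2 ^ (S + 1) * (q ^ n * (1 / 2) ^ (S + 2)) = q ^ (n + 1) * (1 / 2)"
      by (simp add: power_divide)
    then have "(q * 2 ^ (S + 1)) ^ T * thr = (q ^ (n + 1) * (1 / 2)) ^ T"
      unfolding thr_def power_mult by (simp only: power_mult_distrib[symmetric])
    then show ?thesis
      unfolding sum_constant R_def finite_card_transcripts
      by (simp only: of_nat_power of_nat_mult of_nat_numeral q_def power_mult_distrib)
  qed
  finally have "real (card {s \<in> inputs n T. transcript A t m s \<in> B}) - (q ^ (n + 1)) ^ T * (1 / 2) ^ T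
      \<le> (\<Sum>\<tau>\<in>G \<inter> B. N \<tau>)" by simp
  then have "real n * \<beta> ^ T * (real (card {s \<in> inputs n T. transcript A t m s \<in> B}) - (q ^ (n + 1)) ^ T * (1 / 2) ^ T)
      \<le> real n * \<beta> ^ T * (\<Sum>\<tau>\<in>G \<inter> B. N \<tau>)"
    using \<beta> by (intro mult_left_mono) auto
  also have "\<dots> = (\<Sum>\<tau>\<in>G \<inter> B. real n * \<beta> ^ T * N \<tau>)" by (rule sum_distrib_left)
  also have "\<dots> \<le> (\<Sum>\<tau>\<in>G \<inter> B. \<Sum>i<n. \<Sum>s\<in>cell n A t m T \<tau>. weight \<delta> i s)"
    unfolding N_def \<beta>_def
    by (intro sum_mono sum_weight_cell_ge[OF q2 n \<eta> \<delta>]) (auto simp: G_def thr_def q_def N_def)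
  \<comment> \<open>Weights are nonnegative, so the atypical cells can be put back on this
    side.\<close>
  also have "\<dots> \<le> (\<Sum>\<tau>\<in>R \<inter> B. \<Sum>i<n. \<Sum>s\<in>cell n A t m T \<tau>. weight \<delta> i s)"
    using finR \<delta> by (intro sum_mono2 sum_nonneg weight_nonneg) (auto simp: G_def)
  also have "\<dots> = (\<Sum>i<n. \<Sum>\<tau>\<in>R \<inter> B. \<Sum>s\<in>cell n A t m T \<tau>. weight \<delta> i s)"
    by (rule sum.swap)
  also have "\<dots> = (\<Sum>i<n. \<Sum>s \<in> {s \<in> inputs n T. transcript A t m s \<in> B}. weight \<delta> i s)"
    by (simp add: split)
  finally show ?thesis by (simp add: \<beta>_def q_def)
qed

section \<open>Deviation bounds\<close>

text \<open>Chernoff's method for increments that may depend on the past through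
  \<open>\<sigma>\<close>. The scale \<open>\<tau>\<close> may exceed \<open>T\<close>, since
  deviations are later measured against all days, including the correcting ones.\<close>

lemma card_deviation_ge:
  fixes dev :: "'s \<Rightarrow> 'p::finite expert_input \<Rightarrow> real" and \<gamma> \<tau> :: real
  assumes Nil: "\<And>\<sigma>. dev \<sigma> [] = 0"
    and Cons: "\<And>\<sigma> x y s. dev \<sigma> ((x, y) # s) = inc \<sigma> x y + dev (\<nu> \<sigma> x y) s"
    and inc: "\<And>h \<sigma> x. \<bar>h\<bar> \<le> 1 \<Longrightarrow> (\<Sum>y\<in>UNIV. exp (h * inc \<sigma> x y)) \<le> real CARD('p) * exp (h\<^sup>2)"
    and \<gamma>: "0 \<le> \<gamma>" "\<gamma> \<le> 1" and T: "real T \<le> \<tau>"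
  shows "real (card {s \<in> inputs n T. \<gamma> * \<tau> \<le> \<bar>dev \<sigma> s\<bar>})
    \<le> (real CARD('p) ^ (n + 1)) ^ T * (2 * exp (- (\<gamma>\<^sup>2 * \<tau> / 4)))"
proof -
  define Q where "Q = (real CARD('p) ^ (n + 1)) ^ T"
  have one_sided: "real (card {s \<in> inputs n T. \<gamma> * \<tau> \<le> \<epsilon> * dev \<sigma> s}) \<le> Q * exp (- (\<gamma>\<^sup>2 * \<tau> / 4))"
    if \<epsilon>: "\<epsilon> = 1 \<or> \<epsilon> = - 1" for \<epsilon> :: real
  proof -
    \<comment> \<open>The absolute value \<open>\<gamma> / 2\<close> minimizes
      \<open>h\<^sup>2 * \<tau> - h * \<gamma> * \<tau>\<close> over positive \<open>h\<close>; the
      sign selects the tail.\<close>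
    define h where "h = \<epsilon> * \<gamma> / 2"
    have h: "\<bar>h\<bar> \<le> 1" "h\<^sup>2 = \<gamma>\<^sup>2 / 4" using \<epsilon> \<gamma> by (auto simp: h_def power2_eq_square)
    have "real (card {s \<in> inputs n T. \<gamma> * \<tau> \<le> \<epsilon> * dev \<sigma> s}) * exp (\<gamma>\<^sup>2 * \<tau> / 2)
        = (\<Sum>s\<in>{s \<in> inputs n T. \<gamma> * \<tau> \<le> \<epsilon> * dev \<sigma> s}. exp (\<gamma>\<^sup>2 * \<tau> / 2))" by simp
    also have "\<dots> \<le> (\<Sum>s\<in>{s \<in> inputs n T. \<gamma> * \<tau> \<le> \<epsilon> * dev \<sigma> s}. exp (h * dev \<sigma> s))"
    proof (rule sum_mono)
      fix s assume "s \<in> {s \<in> inputs n T. \<gamma> * \<tau> \<le> \<epsilon> * dev \<sigma> s}"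
      then have "\<gamma> / 2 * (\<gamma> * \<tau>) \<le> \<gamma> / 2 * (\<epsilon> * dev \<sigma> s)" using \<gamma> by (intro mult_left_mono) auto
      then show "exp (\<gamma>\<^sup>2 * \<tau> / 2) \<le> exp (h * dev \<sigma> s)" by (simp add: h_def power2_eq_square mult_ac)
    qed
    also have "\<dots> \<le> (\<Sum>s\<in>inputs n T. exp (h * dev \<sigma> s))" by (rule sum_mono2) auto
    also have "\<dots> \<le> (real CARD('p) ^ (n + 1) * exp (h\<^sup>2)) ^ T"
    proof (rule sum_inputs_le_power[where \<Phi> = "\<lambda>\<sigma> s. exp (h * dev \<sigma> s)"
          and \<phi> = "\<lambda>\<sigma> x y. exp (h * inc \<sigma> x y)" and \<nu> = \<nu>])
      show "exp (h * dev \<sigma> ((x, y) # s)) = exp (h * inc \<sigma> x y) * exp (h * dev (\<nu> \<sigma> x y) s)" for \<sigma> x y s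
        by (simp add: Cons exp_add[symmetric] algebra_simps)
    qed (use inc[OF h(1)] Nil in auto)
    also have "\<dots> = Q * exp (real T * h\<^sup>2)"
      by (simp add: Q_def power_mult_distrib exp_of_nat_mult)
    also have "\<dots> \<le> Q * exp (\<gamma>\<^sup>2 * \<tau> / 4)"
    proof (rule mult_left_mono)
      have "real T * h\<^sup>2 \<le> \<tau> * h\<^sup>2" using T by (intro mult_right_mono) auto
      also have "\<dots> = \<gamma>\<^sup>2 * \<tau> / 4" by (simp add: h(2))
      finally have "real T * h\<^sup>2 \<le> \<gamma>\<^sup>2 * \<tau> / 4" .
      then show "exp (real T * h\<^sup>2) \<le> exp (\<gamma>\<^sup>2 * \<tau> / 4)" by simp
    qed (simp add: Q_def)
    finally have "real (card {s \<in> inputs n T. \<gamma> * \<tau> \<le> \<epsilon> * dev \<sigma> s}) \<le> Q * exp (\<gamma>\<^sup>2 * \<tau> / 4) / exp (\<gamma>\<^sup>2 * \<tau> / 2)"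
      by (simp add: pos_le_divide_eq)
    also have "\<dots> = Q * exp (- (\<gamma>\<^sup>2 * \<tau> / 4))"
    proof -
      have "Q * exp (u / 4) / exp (u / 2) = Q * exp (- (u / 4))" for u :: real
      proof -
        have "exp (- (u / 4)) * exp (u / 2) = exp (u / 4)" by (simp add: exp_add[symmetric])
        then show ?thesis by (simp add: divide_eq_eq mult.assoc)
      qed
      then show ?thesis .
    qed
    finally show ?thesis .
  qed
  let ?D = "\<lambda>\<epsilon>. {s \<in> inputs n T. \<gamma> * \<tau> \<le> \<epsilon> * dev \<sigma> s}"
  have "{s \<in> inputs n T. \<gamma> * \<tau> \<le> \<bar>dev \<sigma> s\<bar>} = ?D 1 \<union> ?D (- 1)" by auto
  then have "real (card {s \<in> inputs n T. \<gamma> * \<tau> \<le> \<bar>dev \<sigma> s\<bar>}) \<le> real (card (?D 1)) + real (card (?D (- 1)))"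
    using card_Un_le[of "?D 1" "?D (- 1)"] by (simp only: of_nat_add[symmetric] of_nat_le_iff)
  also have "\<dots> \<le> Q * exp (- (\<gamma>\<^sup>2 * \<tau> / 4)) + Q * exp (- (\<gamma>\<^sup>2 * \<tau> / 4))"
    by (intro add_mono one_sided) auto
  finally show ?thesis by (simp add: Q_def)
qed

text \<open>Each prediction is made before its outcome is drawn, so whatever the memory holds, it
  errs with probability \<open>1 - 1 / q\<close>. The state consists of the day and the
  memory.\<close>

lemma card_mistakes_deviation:
  fixes A :: "'p::finite det_alg" and \<gamma> \<tau> :: real
  assumes "0 \<le> \<gamma>" "\<gamma> \<le> 1" "real T \<le> \<tau>"
  shows "real (card {s \<in> inputs n T. \<gamma> * \<tau> \<le> \<bar>real (mistakes A s) - (1 - 1 / real CARD('p)) * real T\<bar>})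
    \<le> (real CARD('p) ^ (n + 1)) ^ T * (2 * exp (- (\<gamma>\<^sup>2 * \<tau> / 4)))"
proof -
  let ?\<mu> = "1 - 1 / real CARD('p)"
  define dev where "dev = (\<lambda>(t, m) s. real (mistakes_from A t m s) - ?\<mu> * real (length s))"
  have "{s \<in> inputs n T. \<gamma> * \<tau> \<le> \<bar>real (mistakes A s) - ?\<mu> * real T\<bar>} =
      {s \<in> inputs n T. \<gamma> * \<tau> \<le> \<bar>dev (0, start A) s\<bar>}"
    by (auto simp: dev_def mistakes_def inputs_def)
  moreover have "real (card {s \<in> inputs n T. \<gamma> * \<tau> \<le> \<bar>dev (0, start A) s\<bar>})
      \<le> (real CARD('p) ^ (n + 1)) ^ T * (2 * exp (- (\<gamma>\<^sup>2 * \<tau> / 4)))"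
  proof (rule card_deviation_ge[where inc = "\<lambda>(t, m) x y. (if predict A t m x = y then 0 else 1) - ?\<mu>"
        and \<nu> = "\<lambda>(t, m) x y. (Suc t, update A t m x y)"])
    fix h :: real and \<sigma> :: "nat \<times> bool list" and x :: "'p list"
    assume "\<bar>h\<bar> \<le> 1"
    then show "(\<Sum>y\<in>UNIV. exp (h * (case \<sigma> of (t, m) \<Rightarrow> \<lambda>x y. (if predict A t m x = y then 0 else 1) - ?\<mu>) x y))
        \<le> real CARD('p) * exp (h\<^sup>2)"
      by (cases \<sigma>) (simp add: sum_exp_centred_le)
  qed (use assms in \<open>auto simp: dev_def algebra_simps add_divide_distrib\<close>)
  ultimately show ?thesis by simp
qed

definition misses :: "'p \<Rightarrow> 'p list \<Rightarrow> nat" where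
  "misses b ys = length (filter (\<lambda>y. b \<noteq> y) ys)"

text \<open>The state counts how many of the first \<open>k\<close> days remain; afterwards the
  increment is 0, which also meets the moment bound.\<close>

lemma card_misses_deviation:
  fixes b :: "'p::finite" and \<gamma> \<tau> :: real
  assumes "0 \<le> \<gamma>" "\<gamma> \<le> 1" "real T \<le> \<tau>" "k \<le> T"
  shows "real (card {s \<in> inputs n T. \<gamma> * \<tau> \<le> \<bar>real (misses b (take k (map snd s))) - (1 - 1 / real CARD('p)) * real k\<bar>})
    \<le> (real CARD('p) ^ (n + 1)) ^ T * (2 * exp (- (\<gamma>\<^sup>2 * \<tau> / 4)))"
proof -
  let ?\<mu> = "1 - 1 / real CARD('p)"
  define dev where "dev k s = real (misses b (take k (map snd s))) - ?\<mu> * real (min k (length s))"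
    for k :: nat and s :: "'p expert_input"
  have "{s \<in> inputs n T. \<gamma> * \<tau> \<le> \<bar>real (misses b (take k (map snd s))) - ?\<mu> * real k\<bar>} =
      {s \<in> inputs n T. \<gamma> * \<tau> \<le> \<bar>dev k s\<bar>}"
    using assms(4) by (auto simp: dev_def inputs_def min_def)
  moreover have "real (card {s \<in> inputs n T. \<gamma> * \<tau> \<le> \<bar>dev k s\<bar>})
      \<le> (real CARD('p) ^ (n + 1)) ^ T * (2 * exp (- (\<gamma>\<^sup>2 * \<tau> / 4)))"
  proof (rule card_deviation_ge[where inc = "\<lambda>k x y. if k = 0 then 0 else (if b = y then 0 else 1) - ?\<mu>"
        and \<nu> = "\<lambda>k x y. k - 1"])
    fix h :: real and k :: nat and x :: "'p list"
    assume "\<bar>h\<bar> \<le> 1"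
    then show "(\<Sum>y\<in>UNIV. exp (h * (if k = 0 then 0 else (if b = y then 0 else 1) - ?\<mu>)))
        \<le> real CARD('p) * exp (h\<^sup>2)"
      by (cases "k = 0") (simp_all add: sum_exp_centred_le)
  next
    fix k :: nat and x :: "'p list" and y s
    show "dev k ((x, y) # s) = (if k = 0 then 0 else (if b = y then 0 else 1) - ?\<mu>) + dev (k - 1) s"
      by (cases k) (auto simp: dev_def misses_def algebra_simps)
  qed (use assms in \<open>auto simp: dev_def misses_def\<close>)
  ultimately show ?thesis by simp
qed

section \<open>The planted distribution and the failure event\<close>

text \<open>The value \<open>c = 1\<close> gives the normalization, and \<open>c = exp 1\<close> the
  exponential moment of a mistake of the planted expert.\<close>

lemma sum_density:
  "(\<Sum>y\<in>UNIV. density \<delta> b y * (if b = y then 1 else c)) =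
    real CARD('p) + (real CARD('p) - 1) * \<delta> * (c - 1)" for b :: "'p::finite"
proof -
  have "(\<Sum>y\<in>UNIV. density \<delta> b y * (if b = y then 1 else c)) =
      (\<Sum>y\<in>UNIV. if b = y then real CARD('p) - (real CARD('p) - 1) * \<delta> else \<delta> * c)"
    by (intro sum.cong) (auto simp: density_def)
  then show ?thesis by (simp add: sum_if_eq algebra_simps)
qed

lemma sum_weight_le:
  assumes "0 \<le> \<delta>" "\<delta> \<le> 1"
  shows "(\<Sum>s\<in>inputs n T. weight \<delta> i (s :: 'p::finite expert_input)) \<le> (real CARD('p) ^ (n + 1)) ^ T"
proof -
  have "(\<Sum>s\<in>inputs n T. weight \<delta> i (s :: 'p::finite expert_input)) \<le> (real CARD('p) ^ (n + 1) * 1) ^ T"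
  proof (rule sum_inputs_le_power[where \<Phi> = "\<lambda>_ :: unit. weight \<delta> i" and \<phi> = "\<lambda>_ x y. density \<delta> (x ! i) y"
        and \<nu> = "\<lambda>_ _ _. ()"])
    fix x :: "'p list"
    show "sum (density \<delta> (x ! i)) UNIV \<le> real CARD('p) * 1"
      using sum_density[of \<delta> "x ! i" 1] by simp
  qed (use assms density_nonneg in auto)
  then show ?thesis by simp
qed

text \<open>Markov's inequality for the exponential of the number of mistakes. The planted expert
  errs with probability \<open>(1 - 1 / q) * \<delta>\<close> on each day, which costs at most
  \<open>exp (2 * \<delta>)\<close> per day since \<open>exp 1 - 1 \<le> 2\<close>.\<close>

lemma sum_weight_many_mistakes_le:
  fixes \<gamma> \<tau> :: real
  assumes "0 \<le> \<delta>" "\<delta> \<le> 1"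
  shows "(\<Sum>s\<in>{s \<in> inputs n T. \<gamma> * \<tau> \<le> real (expert_mistakes s i)}. weight \<delta> i (s :: 'p::finite expert_input))
    \<le> (real CARD('p) ^ (n + 1)) ^ T * exp (2 * \<delta> * real T - \<gamma> * \<tau>)"
proof -
  let ?q = "real CARD('p)"
  have q: "1 \<le> ?q" using one_le_card_finite[where 'a='p] by linarith
  have "(\<Sum>s\<in>{s \<in> inputs n T. \<gamma> * \<tau> \<le> real (expert_mistakes s i)}. weight \<delta> i (s :: 'p expert_input)) * exp (\<gamma> * \<tau>)
      = (\<Sum>s\<in>{s \<in> inputs n T. \<gamma> * \<tau> \<le> real (expert_mistakes s i)}. weight \<delta> i (s :: 'p expert_input) * exp (\<gamma> * \<tau>))"
    by (rule sum_distrib_right)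
  also have "\<dots> \<le> (\<Sum>s\<in>{s \<in> inputs n T. \<gamma> * \<tau> \<le> real (expert_mistakes s i)}. weight \<delta> i (s :: 'p expert_input) * exp (real (expert_mistakes s i)))"
    using assms by (intro sum_mono mult_left_mono weight_nonneg) auto
  also have "\<dots> \<le> (\<Sum>s\<in>inputs n T. weight \<delta> i (s :: 'p expert_input) * exp (real (expert_mistakes s i)))"
    using assms by (intro sum_mono2) (auto simp: weight_nonneg)
  also have "\<dots> \<le> (?q ^ (n + 1) * exp (2 * \<delta>)) ^ T"
  proof (rule sum_inputs_le_power[where \<Phi> = "\<lambda>_ :: unit. \<lambda>s. weight \<delta> i s * exp (real (expert_mistakes s i))"
        and \<phi> = "\<lambda>_ x y. density \<delta> (x ! i) y * (if x ! i = y then 1 else exp 1)"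
        and \<nu> = "\<lambda>_ _ _. ()"])
    fix x :: "'p list"
    have "exp 1 - 1 \<le> (2 :: real)" using exp_le by simp
    then have "(?q - 1) * \<delta> * (exp 1 - 1) \<le> ?q * \<delta> * 2"
      using q assms by (intro mult_mono) auto
    then have "?q + (?q - 1) * \<delta> * (exp 1 - 1) \<le> ?q * (1 + 2 * \<delta>)" by (simp add: algebra_simps)
    also have "\<dots> \<le> ?q * exp (2 * \<delta>)" by (intro mult_left_mono exp_ge_add_one_self) simp
    finally show "(\<Sum>y\<in>UNIV. density \<delta> (x ! i) y * (if x ! i = y then 1 else exp 1)) \<le> ?q * exp (2 * \<delta>)"
      by (simp only: sum_density)
  qed (use assms density_nonneg in \<open>auto simp: expert_mistakes_def exp_add\<close>)
  also have "\<dots> = (?q ^ (n + 1)) ^ T * exp (2 * \<delta> * real T)"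
    by (simp add: power_mult_distrib exp_of_nat_mult[symmetric] mult_ac)
  finally show ?thesis by (simp add: exp_diff pos_le_divide_eq)
qed

text \<open>The event \<open>F\<close> is typical under the uniform distribution and readable from
  the transcript, so it keeps a good part of its probability after planting. The mistakes of the
  planted expert are not readable from the transcript; that condition is imposed afterwards, by a
  tail bound under the planted distribution itself.\<close>

lemma sum_weight_failure_ge:
  fixes A :: "'p::finite det_alg" and b :: 'p and \<gamma> \<tau> :: real
  assumes q2: "2 \<le> CARD('p)" and n: "0 < n"
    and \<eta>: "0 < \<eta>" "real CARD('p) * \<eta> \<le> 1" and \<delta>: "0 < \<delta>" "\<delta> \<le> 1"
    and upd: "\<forall>t m x y. length m = S \<and> length x = n \<longrightarrow> length (update A t m x y) = S"
    and start: "length (start A) = S"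
    and \<gamma>: "0 \<le> \<gamma>" "\<gamma> \<le> 1" and T: "real T \<le> \<tau>" and k: "k \<le> T"
  defines "\<mu> \<equiv> 1 - 1 / real CARD('p)"
  defines "\<beta> \<equiv> (1 - real CARD('p) * \<eta>) * (1 / 2) powr (2 * ln (1 / \<delta>) / \<eta>\<^sup>2 * real (S + 2) / real n)"
  defines "F \<equiv> {s \<in> inputs n T. \<bar>real (mistakes A s) - \<mu> * real T\<bar> < \<gamma> * \<tau> \<and>
      \<bar>real (misses b (take k (map snd s))) - \<mu> * real k\<bar> < \<gamma> * \<tau>}"
  shows "real n * (real CARD('p) ^ (n + 1)) ^ T *
      (\<beta> ^ T * (1 - (1 / 2) ^ T - 4 * exp (- (\<gamma>\<^sup>2 * \<tau> / 4))) - exp (2 * \<delta> * real T - \<gamma> * \<tau>))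
    \<le> (\<Sum>i<n. \<Sum>s\<in>{s \<in> F. real (expert_mistakes s i) < \<gamma> * \<tau>}. weight \<delta> i s)"
proof -
  define Q where "Q = (real CARD('p) ^ (n + 1)) ^ T"
  define e where "e = exp (- (\<gamma>\<^sup>2 * \<tau> / 4))"
  have \<beta>: "0 \<le> \<beta>" using \<eta> by (simp add: \<beta>_def)
  \<comment> \<open>The event \<open>F\<close> in terms of transcripts: the flags count the
    mistakes, and the first components are the outcomes.\<close>
  define B where "B = {tr :: ('p \<times> bool list \<times> bool) list.
      \<bar>real (length (filter (\<lambda>(y, m, correct). \<not> correct) tr)) - \<mu> * real T\<bar> < \<gamma> * \<tau> \<and>
      \<bar>real (misses b (take k (map fst tr))) - \<mu> * real k\<bar> < \<gamma> * \<tau>}"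
  have F_B: "F = {s \<in> inputs n T. transcript A 0 (start A) s \<in> B}"
    by (simp add: F_def B_def mistakes_def mistakes_from_transcript[symmetric] map_fst_transcript)
  have finF: "finite F" by (simp add: F_def)
  let ?I = "inputs n T :: 'p expert_input set"
  let ?B1 = "{s \<in> ?I. \<gamma> * \<tau> \<le> \<bar>real (mistakes A s) - \<mu> * real T\<bar>}"
  let ?B2 = "{s \<in> ?I. \<gamma> * \<tau> \<le> \<bar>real (misses b (take k (map snd s))) - \<mu> * real k\<bar>}"
  have "?I \<subseteq> F \<union> (?B1 \<union> ?B2)" by (auto simp: F_def)
  then have "card ?I \<le> card (F \<union> (?B1 \<union> ?B2))" using finF by (intro card_mono) auto
  also have "\<dots> \<le> card F + (card ?B1 + card ?B2)"
    using card_Un_le[of F "?B1 \<union> ?B2"] card_Un_le[of ?B1 ?B2] by linarith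
  finally have "real (card ?I) \<le> real (card F) + (real (card ?B1) + real (card ?B2))" by linarith
  moreover have "real (card ?I) = Q" by (simp add: card_inputs Q_def)
  moreover have "real (card ?B1) \<le> Q * (2 * e)"
    unfolding Q_def e_def \<mu>_def by (rule card_mistakes_deviation[OF \<gamma> T])
  moreover have "real (card ?B2) \<le> Q * (2 * e)"
    unfolding Q_def e_def \<mu>_def by (rule card_misses_deviation[OF \<gamma> T k])
  ultimately have cF: "Q * (1 - 4 * e) \<le> real (card F)" by (simp add: algebra_simps)
  have "real n * \<beta> ^ T * (Q * (1 - 4 * e) - Q * (1 / 2) ^ T) \<le> real n * \<beta> ^ T * (real (card F) - Q * (1 / 2) ^ T)"
    using cF \<beta> by (intro mult_left_mono) auto
  also have "\<dots> \<le> (\<Sum>i<n. \<Sum>s\<in>F. weight \<delta> i s)"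
    using sum_weight_ge[OF q2 n \<eta> \<delta> upd start, of T 0 B] unfolding F_B[symmetric] \<beta>_def Q_def .
  also have "\<dots> \<le> (\<Sum>i<n. (\<Sum>s\<in>{s \<in> F. real (expert_mistakes s i) < \<gamma> * \<tau>}. weight \<delta> i s) + Q * exp (2 * \<delta> * real T - \<gamma> * \<tau>))"
  proof (rule sum_mono)
    fix i
    have "(\<Sum>s\<in>F. weight \<delta> i s) \<le> (\<Sum>s\<in>{s \<in> F. real (expert_mistakes s i) < \<gamma> * \<tau>} \<union> {s \<in> ?I. \<gamma> * \<tau> \<le> real (expert_mistakes s i)}. weight \<delta> i s)"
      using finF \<delta> by (intro sum_mono2) (auto simp: weight_nonneg F_def)
    also have "\<dots> = (\<Sum>s\<in>{s \<in> F. real (expert_mistakes s i) < \<gamma> * \<tau>}. weight \<delta> i s) + (\<Sum>s\<in>{s \<in> ?I. \<gamma> * \<tau> \<le> real (expert_mistakes s i)}. weight \<delta> i s)"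
      using finF by (intro sum.union_disjoint) auto
    also have "(\<Sum>s\<in>{s \<in> ?I. \<gamma> * \<tau> \<le> real (expert_mistakes s i)}. weight \<delta> i s) \<le> Q * exp (2 * \<delta> * real T - \<gamma> * \<tau>)"
      unfolding Q_def using \<delta> by (intro sum_weight_many_mistakes_le) auto
    finally show "(\<Sum>s\<in>F. weight \<delta> i s) \<le> (\<Sum>s\<in>{s \<in> F. real (expert_mistakes s i) < \<gamma> * \<tau>}. weight \<delta> i s) + Q * exp (2 * \<delta> * real T - \<gamma> * \<tau>)"
      by simp
  qed
  finally have "real n * Q * (\<beta> ^ T * (1 - (1 / 2) ^ T - 4 * e) - exp (2 * \<delta> * real T - \<gamma> * \<tau>))
      \<le> (\<Sum>i<n. \<Sum>s\<in>{s \<in> F. real (expert_mistakes s i) < \<gamma> * \<tau>}. weight \<delta> i s)"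
    by (simp add: sum.distrib algebra_simps)
  then show ?thesis by (simp only: Q_def e_def)
qed

section \<open>Inputs with a prescribed number of mistakes of the best expert\<close>

definition blank :: "nat \<Rightarrow> 'p list \<Rightarrow> 'p expert_input \<Rightarrow> 'p expert_input" where
  "blank k z s = map (\<lambda>(x, y). (z, y)) (take k s) @ drop k s"

text \<open>Simulates \<open>A\<close> on the blanked input while reading a uniform one, so that the
  estimates for uniform inputs apply to it. The simulation consults only the day index, which is not
  charged to the memory.\<close>

definition blank_alg :: "nat \<Rightarrow> 'p list \<Rightarrow> 'p det_alg \<Rightarrow> 'p det_alg" where
  "blank_alg k z A = A\<lparr>predict := \<lambda>t m x. predict A t m (if t < k then z else x),
     update := \<lambda>t m x. update A t m (if t < k then z else x)\<rparr>"

lemma mistakes_blank_alg: "mistakes (blank_alg k z A) s = mistakes A (blank k z s)"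
proof -
  \<comment> \<open>Truncated subtraction makes \<open>k - t\<close> vanish once the blanked days
    are over.\<close>
  have "mistakes_from (blank_alg k z A) t m s = mistakes_from A t m (blank (k - t) z s)" for t m
  proof (induction s arbitrary: t m)
    case (Cons d s)
    obtain x y where d: "d = (x, y)" by fastforce
    show ?case
    proof (cases "t < k")
      case True
      then have "blank (k - t) z (d # s) = (z, y) # blank (k - Suc t) z s"
        by (simp add: blank_def d Suc_diff_Suc[symmetric])
      then show ?thesis using True Cons by (simp add: d blank_alg_def)
    next
      case False
      then show ?thesis using Cons[of "Suc t"] by (simp add: d blank_alg_def blank_def)
    qed
  qed (simp add: blank_def)
  from this[of 0 "start A"] show ?thesis by (simp add: mistakes_def blank_alg_def)
qed

lemma expert_mistakes_append: "expert_mistakes (s @ s') j = expert_mistakes s j + expert_mistakes s' j"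
  by (simp add: expert_mistakes_def)

lemma expert_mistakes_blank:
  assumes "j < n"
  shows "expert_mistakes (blank k (replicate n b) s) j = misses b (take k (map snd s)) + expert_mistakes (drop k s) j"
proof -
  have "expert_mistakes (map (\<lambda>(x, y). (replicate n b, y)) s) j = misses b (map snd s)" for s :: "'a expert_input"
    using assms by (induction s) (auto simp: expert_mistakes_def misses_def)
  then show ?thesis by (simp add: blank_def expert_mistakes_append take_map)
qed

lemma expert_mistakes_drop_le: "expert_mistakes (drop k s) j \<le> expert_mistakes s j"
  using expert_mistakes_append[of "take k s" "drop k s" j] by simp

lemma mistakes_from_append_ge: "mistakes_from A t m s \<le> mistakes_from A t m (s @ s')"
  by (induction A t m s rule: mistakes_from.induct) auto

lemma blank_in_inputs: "s \<in> inputs n T \<Longrightarrow> length z = n \<Longrightarrow> blank k z s \<in> inputs n T"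
  by (auto simp: inputs_def blank_def dest: in_set_takeD in_set_dropD)

text \<open>The last \<open>r\<close> days are unanimous for \<open>b\<close>: outcome
  \<open>b'\<close> costs every expert one mistake, outcome \<open>b\<close> costs none. Thus
  \<open>v\<close> raises all experts equally, up to the prescribed \<open>M\<close>.\<close>

definition pad :: "nat \<Rightarrow> 'p \<Rightarrow> 'p \<Rightarrow> nat \<Rightarrow> nat \<Rightarrow> nat \<Rightarrow> 'p expert_input \<Rightarrow> 'p expert_input" where
  "pad n b b' k r M s =
    (let s' = blank k (replicate n b) s; v = M - best_mistakes n s'
     in s' @ replicate v (replicate n b, b') @ replicate (r - v) (replicate n b, b))"

text \<open>By \<open>upper\<close>, expert \<open>i\<close> shows that the best expert has at most
  \<open>M\<close> mistakes before the correction, so the subtraction in \<open>v\<close> is not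
  truncated. By \<open>lower\<close>, the \<open>r\<close> final days suffice.\<close>

lemma pad_props:
  assumes s: "s \<in> inputs n T" and i: "i < n" and b: "b \<noteq> b'"
    and upper: "misses b (take k (map snd s)) + expert_mistakes s i \<le> M"
    and lower: "M \<le> misses b (take k (map snd s)) + r"
  shows "pad n b b' k r M s \<in> inputs n (T + r)" "best_mistakes n (pad n b b' k r M s) = M"
proof -
  define s' where "s' = blank k (replicate n b) s"
  define v where "v = M - best_mistakes n s'"
  have pad: "pad n b b' k r M s = s' @ replicate v (replicate n b, b') @ replicate (r - v) (replicate n b, b)"
    by (simp add: pad_def s'_def v_def Let_def)
  have s': "s' \<in> inputs n T" unfolding s'_def using s by (intro blank_in_inputs) auto
  have each: "expert_mistakes s' j = misses b (take k (map snd s)) + expert_mistakes (drop k s) j" if "j < n" for j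
    unfolding s'_def by (rule expert_mistakes_blank[OF that])
  have ne: "{..<n} \<noteq> {}" using i by auto
  have "best_mistakes n s' \<le> expert_mistakes s' i"
    unfolding best_mistakes_def using i by (intro Min_le) auto
  also have "\<dots> \<le> M" using each[OF i] expert_mistakes_drop_le[of k s i] upper by linarith
  finally have le: "best_mistakes n s' \<le> M" .
  \<comment> \<open>No expert can avoid the mistakes of the unanimous first \<open>k\<close> days,
    and this bounds the correction \<open>v\<close>.\<close>
  have "misses b (take k (map snd s)) \<le> best_mistakes n s'"
    unfolding best_mistakes_def using ne each by (intro Min.boundedI) auto
  then have v: "v \<le> r" using lower by (simp add: v_def)
  show "pad n b b' k r M s \<in> inputs n (T + r)"
    unfolding pad using s' v by (auto simp: inputs_def)
  have "expert_mistakes (pad n b b' k r M s) j = expert_mistakes s' j + v" if "j < n" for j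
    unfolding pad using that b by (simp add: expert_mistakes_append) (simp add: expert_mistakes_def)
  then have "expert_mistakes (pad n b b' k r M s) ` {..<n} = (\<lambda>m. m + v) ` expert_mistakes s' ` {..<n}"
    by (auto simp: image_image intro!: image_cong)
  then have "best_mistakes n (pad n b b' k r M s) = best_mistakes n s' + v"
    unfolding best_mistakes_def using ne
    by (simp add: mono_Min_commute[of "\<lambda>m. m + v", symmetric] mono_def)
  then show "best_mistakes n (pad n b b' k r M s) = M" using le by (simp add: v_def)
qed

lemma mistakes_pad_ge: "mistakes (blank_alg k (replicate n b) A) s \<le> mistakes A (pad n b b' k r M s)"
  unfolding mistakes_blank_alg by (simp add: pad_def Let_def mistakes_def mistakes_from_append_ge)

section \<open>Averaging over the inputs\<close>

text \<open>The easy direction of Yao's principle: the failing weight is averaged over the random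
  choices and the expectation is exchanged with the sum over \<open>J\<close>.\<close>

lemma yao_minimax:
  fixes \<A> :: "'a pmf" and w :: "'j \<Rightarrow> real"
  assumes fin: "finite J" and w: "\<And>j. j \<in> J \<Longrightarrow> 0 \<le> w j"
    and success: "\<And>j. j \<in> J \<Longrightarrow> 1 - p \<le> measure_pmf.prob \<A> (G j)"
    and fail: "\<And>A. A \<in> set_pmf \<A> \<Longrightarrow> X \<le> (\<Sum>j\<in>{j \<in> J. A \<notin> G j}. w j)"
  shows "X \<le> p * (\<Sum>j\<in>J. w j)"
proof -
  have int: "integrable (measure_pmf \<A>) (\<lambda>A. w j * indicator (- G j) A)" for j
    by (intro integrable_mult_right measure_pmf.integrable_const_bound[where B = 1]) (auto simp: indicator_def)
  have "X = (\<integral>A. X \<partial>measure_pmf \<A>)" by simp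
  also have "\<dots> \<le> (\<integral>A. (\<Sum>j\<in>J. w j * indicator (- G j) A) \<partial>measure_pmf \<A>)"
  proof (rule integral_mono_AE)
    show "AE A in measure_pmf \<A>. X \<le> (\<Sum>j\<in>J. w j * indicator (- G j) A)"
    proof (rule AE_pmfI)
      fix A assume "A \<in> set_pmf \<A>"
      then have "X \<le> (\<Sum>j\<in>{j \<in> J. A \<notin> G j}. w j)" by (rule fail)
      also have "\<dots> = (\<Sum>j\<in>J. w j * indicator (- G j) A)"
        unfolding sum.inter_filter[OF fin] by (intro sum.cong) (auto simp: indicator_def)
      finally show "X \<le> (\<Sum>j\<in>J. w j * indicator (- G j) A)" .
    qed
  qed (use int in auto)
  also have "\<dots> = (\<Sum>j\<in>J. w j * measure_pmf.prob \<A> (- G j))"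
    using int by (subst Bochner_Integration.integral_sum) auto
  also have "\<dots> \<le> (\<Sum>j\<in>J. w j * p)"
  proof (intro sum_mono mult_left_mono w)
    fix j assume "j \<in> J"
    then show "measure_pmf.prob \<A> (- G j) \<le> p"
      using success[of j] measure_pmf.prob_compl[of "G j" \<A>] by (simp add: Compl_eq_Diff_UNIV)
  qed
  finally show ?thesis by (simp add: sum_distrib_left mult.commute)
qed

text \<open>Planted inputs of \<open>T\<close> days are extended by \<open>r\<close> correcting
  days. The conditions \<open>upper\<close> and \<open>lower\<close> make the correction possible,
  and \<open>many\<close> puts the allowed number of mistakes below the number typical for the
  algorithm, so a typical run violates the guarantee.\<close>

lemma failure_probability_lower_bound:
  fixes \<A> :: "'p::finite rand_alg" and \<gamma> p :: real
  assumes q2: "2 \<le> CARD('p)" and n: "0 < n"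
    and \<eta>: "0 < \<eta>" "real CARD('p) * \<eta> \<le> 1" and \<delta>: "0 < \<delta>" "\<delta> \<le> 1"
    and \<gamma>: "0 \<le> \<gamma>" "\<gamma> \<le> 1" and k: "k \<le> T"
    and mem: "uses_memory n S \<A>" and regret: "achieves_regret n (T + r) M R (1 - p) \<A>"
  defines "\<mu> \<equiv> 1 - 1 / real CARD('p)" and "g \<equiv> \<gamma> * real (T + r)"
  defines "\<beta> \<equiv> (1 - real CARD('p) * \<eta>) * (1 / 2) powr (2 * ln (1 / \<delta>) / \<eta>\<^sup>2 * real (S + 2) / real n)"
  assumes upper: "\<mu> * real k + 2 * g \<le> real M" and lower: "real M \<le> \<mu> * real k - g + real r"
    and many: "real M + R * real (T + r) \<le> \<mu> * real T - g" and p: "0 \<le> p"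
  shows "\<beta> ^ T * (1 - (1 / 2) ^ T - 4 * exp (- (\<gamma>\<^sup>2 * real (T + r) / 4))) - exp (2 * \<delta> * real T - g) \<le> p"
proof -
  define Q where "Q = (real CARD('p) ^ (n + 1)) ^ T"
  have Q: "0 < Q" by (simp add: Q_def)
  have T_le: "real T \<le> real (T + r)" by simp
  define x where "x = \<beta> ^ T * (1 - (1 / 2) ^ T - 4 * exp (- (\<gamma>\<^sup>2 * real (T + r) / 4))) - exp (2 * \<delta> * real T - g)"
  obtain b b' :: 'p where b: "b \<noteq> b'"
  proof -
    fix b :: 'p
    have "UNIV \<noteq> {b}"
    proof
      assume "UNIV = {b}"
      then have "CARD('p) \<le> card {b}" by (intro card_mono) auto
      then show False using q2 by simp
    qed
    then show ?thesis using that by blast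
  qed
  \<comment> \<open>Exactly what the correction to \<open>M\<close> requires; it does not mention
    the algorithm, so the hard family is fixed in advance.\<close>
  define valid where "valid i s \<longleftrightarrow> \<bar>real (misses b (take k (map snd s))) - \<mu> * real k\<bar> < g \<and>
    real (expert_mistakes s i) < g" for i and s :: "'p expert_input"
  define J where "J = (SIGMA i:{..<n}. {s \<in> inputs n T. valid i s})"
  define ext where "ext = pad n b b' k r M"
  have finJ: "finite J" unfolding J_def by (intro finite_SigmaI) auto
  have ext: "ext s \<in> inputs n (T + r)" "best_mistakes n (ext s) = M" if "(i, s) \<in> J" for i s
  proof -
    from that have i: "i < n" and s: "s \<in> inputs n T" and v: "valid i s" by (auto simp: J_def)
    have "real (misses b (take k (map snd s)) + expert_mistakes s i) \<le> real M"
      using v upper unfolding valid_def by linarith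
    moreover have "real M \<le> real (misses b (take k (map snd s)) + r)"
      using v lower unfolding valid_def by linarith
    ultimately show "ext s \<in> inputs n (T + r)" "best_mistakes n (ext s) = M"
      unfolding ext_def using pad_props[OF s i b, of k M r] by (simp_all only: of_nat_le_iff)
  qed
  have "real n * Q * x \<le> p * (\<Sum>(i, s)\<in>J. weight \<delta> i s)"
  \<comment> \<open>The index is a pair of planted expert and input, as one input carries a
    different weight for each expert.\<close>
  proof (rule yao_minimax[where G = "\<lambda>(i, s). {A. real (mistakes A (ext s)) \<le> real M + R * real (T + r)}"])
    fix A assume A: "A \<in> set_pmf \<A>"
    let ?A = "blank_alg k (replicate n b) A"
    from A mem have start: "length (start ?A) = S"
      and upd: "\<forall>t m x y. length m = S \<and> length x = n \<longrightarrow> length (update ?A t m x y) = S"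
      by (auto simp: uses_memory_def blank_alg_def)
    have "real n * Q * x \<le> (\<Sum>i<n. \<Sum>s\<in>{s \<in> {s \<in> inputs n T. \<bar>real (mistakes ?A s) - \<mu> * real T\<bar> < g \<and>
      \<bar>real (misses b (take k (map snd s))) - \<mu> * real k\<bar> < g}. real (expert_mistakes s i) < g}. weight \<delta> i s)"
      unfolding Q_def x_def \<beta>_def \<mu>_def g_def
      by (rule sum_weight_failure_ge[OF q2 n \<eta> \<delta> upd start \<gamma> T_le k])
    also have "\<dots> = (\<Sum>(i, s)\<in>(SIGMA i:{..<n}. {s \<in> {s \<in> inputs n T. \<bar>real (mistakes ?A s) - \<mu> * real T\<bar> < g \<and>
      \<bar>real (misses b (take k (map snd s))) - \<mu> * real k\<bar> < g}. real (expert_mistakes s i) < g}). weight \<delta> i s)"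
      by (rule sum.Sigma) auto
    also have "\<dots> \<le> (\<Sum>(i, s)\<in>{j \<in> J. A \<notin> (case j of (i, s) \<Rightarrow> {A. real (mistakes A (ext s)) \<le> real M + R * real (T + r)})}. weight \<delta> i s)"
    proof (rule sum_mono2)
      show "finite {j \<in> J. A \<notin> (case j of (i, s) \<Rightarrow> {A. real (mistakes A (ext s)) \<le> real M + R * real (T + r)})}"
        using finJ by simp
      show "(SIGMA i:{..<n}. {s \<in> {s \<in> inputs n T. \<bar>real (mistakes ?A s) - \<mu> * real T\<bar> < g \<and>
        \<bar>real (misses b (take k (map snd s))) - \<mu> * real k\<bar> < g}. real (expert_mistakes s i) < g})
        \<subseteq> {j \<in> J. A \<notin> (case j of (i, s) \<Rightarrow> {A. real (mistakes A (ext s)) \<le> real M + R * real (T + r)})}"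
      proof clarsimp
        fix i s
        assume i: "i < n" and s: "s \<in> inputs n T" and mist: "\<bar>real (mistakes ?A s) - \<mu> * real T\<bar> < g"
          and v: "\<bar>real (misses b (take k (map snd s))) - \<mu> * real k\<bar> < g" "real (expert_mistakes s i) < g"
        have "real (mistakes ?A s) \<le> real (mistakes A (ext s))"
          unfolding ext_def by (simp add: mistakes_pad_ge)
        then have "\<not> real (mistakes A (ext s)) \<le> real M + R * real (T + r)"
          using mist many by linarith
        then show "(i, s) \<in> J \<and> \<not> real (mistakes A (ext s)) \<le> real M + R * (real T + real r)"
          using i s v by (simp add: J_def valid_def)
      qed
      show "0 \<le> (case j of (i, s) \<Rightarrow> weight \<delta> i s)" for j :: "nat \<times> 'p expert_input"
        using \<delta> by (cases j) (simp add: weight_nonneg)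
    qed
    finally show "real n * Q * x \<le> (\<Sum>j\<in>{j \<in> J. A \<notin> (case j of (i, s) \<Rightarrow> {A. real (mistakes A (ext s)) \<le> real M + R * real (T + r)})}. case j of (i, s) \<Rightarrow> weight \<delta> i s)" .
  next
    fix j assume j: "j \<in> J"
    obtain i s where js: "j = (i, s)" by fastforce
    have "1 - p \<le> measure_pmf.prob \<A> {A. real (mistakes A (ext s)) \<le> real (best_mistakes n (ext s)) + R * real (T + r)}"
      using regret ext[OF j[unfolded js]] unfolding achieves_regret_def by blast
    then show "1 - p \<le> measure_pmf.prob \<A> (case j of (i, s) \<Rightarrow> {A. real (mistakes A (ext s)) \<le> real M + R * real (T + r)})"
      unfolding js ext(2)[OF j[unfolded js]] by simp
  next
    show "0 \<le> (case j of (i, s) \<Rightarrow> weight \<delta> i s)" for j :: "nat \<times> 'p expert_input"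
      using \<delta> by (cases j) (simp add: weight_nonneg)
  qed (rule finJ)
  also have "(\<Sum>(i, s)\<in>J. weight \<delta> i s) \<le> real n * Q"
  proof -
    have "(\<Sum>(i, s)\<in>J. weight \<delta> i s) = (\<Sum>i<n. \<Sum>s\<in>{s \<in> inputs n T. valid i s}. weight \<delta> i s)"
      unfolding J_def by (rule sum.Sigma[symmetric]) auto
    also have "\<dots> \<le> (\<Sum>i<n. \<Sum>s\<in>inputs n T. weight \<delta> i (s :: 'p expert_input))"
      using \<delta> by (intro sum_mono sum_mono2) (auto simp: weight_nonneg)
    also have "\<dots> \<le> (\<Sum>i<n. Q)"
      unfolding Q_def using \<delta> by (intro sum_mono sum_weight_le) auto
    finally show ?thesis by simp
  qed
  finally have "real n * Q * x \<le> p * (real n * Q)" using p by (simp add: mult_left_mono)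
  moreover have "0 < real n * Q" using n Q by simp
  ultimately have "x \<le> p" by (simp only: mult.commute[of p] mult_le_cancel_left_pos)
  then show ?thesis by (simp only: x_def)
qed

section \<open>Choice of the constants\<close>

text \<open>The bound on \<open>c' + R\<close> keeps the allowed mistakes below those of uniform
  guessing, which needs no memory and errs on an expected fraction \<open>1 - 1 / q\<close> of the
  days.\<close>

theorem theoremA3:
  fixes c' R a :: real
  assumes "0 < c'" and "0 \<le> R" and "0 < a"
    and "c' + R < 1 - 1 / real CARD('p::finite)"
  shows "\<exists>\<kappa>>0. \<exists>N. \<forall>n\<ge>N. \<forall>T\<ge>N. \<forall>M. real M = c' * real T \<longrightarrow>
    (\<forall>S (\<A> :: 'p rand_alg).
       uses_memory n S \<A> \<longrightarrow>
       achieves_regret n T M R (1 - 2 powr (- a * real T)) \<A> \<longrightarrow>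
       real S \<ge> \<kappa> * real n)"
proof -
  define q where "q = real CARD('p)"
  define \<mu> where "\<mu> = 1 - 1 / q"
  have "CARD('p) \<noteq> 1" using assms by auto
  then have q2: "2 \<le> CARD('p)" using one_le_card_finite[where 'a='p] by linarith
  then have q: "2 \<le> q" by (simp add: q_def)
  have \<mu>: "0 < \<mu>" "\<mu> \<le> 1" using q by (auto simp: \<mu>_def)
  \<comment> \<open>A tenth of the gap leaves room for the deviations and the correcting days;
    \<open>c' / 4\<close> makes \<open>M\<close> large enough for \<open>k\<close> to be nonnegative
    before rounding.\<close>
  define \<gamma> where "\<gamma> = min ((\<mu> - c' - R) / 10) (c' / 4)"
  have gap: "0 < \<mu> - c' - R" using assms by (simp add: \<mu>_def q_def)
  have "0 < \<gamma>" using gap assms by (simp add: \<gamma>_def)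
  moreover have "\<gamma> \<le> (\<mu> - c' - R) / 10" "\<gamma> \<le> c' / 4" unfolding \<gamma>_def by (rule min.cobounded1, rule min.cobounded2)
  ultimately have \<gamma>: "0 < \<gamma>" "10 * \<gamma> \<le> \<mu> - c' - R" "4 * \<gamma> \<le> c'" by simp_all
  have \<gamma>1: "10 * \<gamma> \<le> 1" using \<gamma> \<mu> assms by linarith
  \<comment> \<open>With this value the planted expert errs too often with weight at most
    \<open>exp (- \<gamma> * T / 2)\<close>, relative to the uniform total.\<close>
  define \<delta> where "\<delta> = \<gamma> / 4"
  have \<delta>: "0 < \<delta>" "\<delta> < 1" using \<gamma> \<gamma>1 by (auto simp: \<delta>_def)
  \<comment> \<open>The admissible loss per day. Both error terms, \<open>2 powr (- a * T)\<close>
    and the planted tail, are then at most \<open>exp (- 2 * e * T)\<close>, negligible against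
    \<open>exp (- e * T)\<close>.\<close>
  define e where "e = min (a * ln 2) (\<gamma> / 2) / 2"
  have e: "0 < e" "2 * e \<le> a * ln 2" "2 * e \<le> \<gamma> / 2"
    using \<gamma>(1) assms(3) unfolding e_def by simp_all
  \<comment> \<open>Half of the loss \<open>e\<close> goes to the factor
    \<open>1 - q * \<eta> = exp (- e / 2)\<close>, the other half to the memory.\<close>
  define \<eta> where "\<eta> = (1 - exp (- e / 2)) / q"
  have \<eta>: "0 < \<eta>" "q * \<eta> = 1 - exp (- e / 2)" using q e by (auto simp: \<eta>_def)
  define C where "C = 2 * ln (1 / \<delta>) / \<eta>\<^sup>2"
  have C: "0 < C" using \<delta> \<eta> by (simp add: C_def)
  \<comment> \<open>Solves \<open>C * (2 * \<kappa>) * ln 2 = e / 2\<close>, where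
    \<open>2 * \<kappa>\<close> will bound \<open>(S + 2) / n\<close>.\<close>
  define \<kappa> where "\<kappa> = e / (4 * C * ln 2)"
  have \<kappa>: "0 < \<kappa>" using e C by (simp add: \<kappa>_def)
  \<comment> \<open>The summands yield, in turn, \<open>2 \<le> \<kappa> * n\<close> to absorb the 2
    in \<open>S + 2\<close>, room for rounding, deviation terms of total at most
    \<open>1 / 4\<close>, and the final contradiction.\<close>
  define N where "N = nat \<lceil>2 / \<kappa> + 10 / \<gamma> + 60 / \<gamma>\<^sup>2 + 4 / e\<rceil> + 1"
  have "\<kappa> * real n \<le> real S"
    if nN: "N \<le> n" and TN: "N \<le> T" and M: "real M = c' * real T" and mem: "uses_memory n S \<A>"
      and regret: "achieves_regret n T M R (1 - 2 powr (- a * real T)) \<A>"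
    for n T M S and \<A> :: "'p rand_alg"
  proof (rule ccontr)
    assume "\<not> \<kappa> * real n \<le> real S"
    then have S: "real S \<le> \<kappa> * real n" by simp
    have pos: "0 < 2 / \<kappa>" "0 < 10 / \<gamma>" "0 < 60 / \<gamma>\<^sup>2" "0 < 4 / e" using \<kappa> \<gamma> e by auto
    have Nge: "2 / \<kappa> + 10 / \<gamma> + 60 / \<gamma>\<^sup>2 + 4 / e \<le> real N" unfolding N_def by linarith
    have n: "0 < n" using nN by (simp add: N_def)
    have "2 / \<kappa> \<le> real n" using Nge pos nN by linarith
    then have n\<kappa>: "2 \<le> \<kappa> * real n" using \<kappa> by (simp add: field_simps)
    have "10 / \<gamma> \<le> real T" "60 / \<gamma>\<^sup>2 \<le> real T" "4 / e \<le> real T" using Nge pos TN by linarith+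
    then have T: "10 \<le> \<gamma> * real T" "60 \<le> \<gamma>\<^sup>2 * real T" "4 \<le> e * real T"
      using \<gamma> e by (simp_all add: field_simps)
    have T100: "100 \<le> real T"
    proof -
      have "10 * \<gamma> * real T \<le> 1 * real T" using \<gamma>1 by (intro mult_right_mono) auto
      then show ?thesis using T(1) by linarith
    qed
    \<comment> \<open>Rounding \<open>k\<close> down loses at most \<open>\<mu> \<le> 1\<close>, so
      the correction needs \<open>3 * \<gamma> * T + \<mu>\<close> days; the \<open>+ 1\<close>
      covers \<open>\<mu>\<close>.\<close>
    define r where "r = nat \<lceil>3 * (\<gamma> * real T)\<rceil> + 1"
    have r: "3 * (\<gamma> * real T) + 1 \<le> real r" "real r \<le> 3 * (\<gamma> * real T) + 2"
      unfolding r_def using T(1) by linarith+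
    \<comment> \<open>The largest number of unanimous days whose typical cost stays below
      \<open>M\<close> by the slack \<open>2 * \<gamma> * T\<close>.\<close>
    define k where "k = nat \<lfloor>(real M - 2 * (\<gamma> * real T)) / \<mu>\<rfloor>"
    have gT: "10 * (\<gamma> * real T) \<le> \<mu> * real T - real M - R * real T" "4 * (\<gamma> * real T) \<le> real M"
      "10 * (\<gamma> * real T) \<le> real T"
      using mult_right_mono[OF \<gamma>(2), of "real T"] mult_right_mono[OF \<gamma>(3), of "real T"]
        mult_right_mono[OF \<gamma>1, of "real T"] M
      by (simp_all add: algebra_simps)
    have RT: "0 \<le> R * real T" using assms by simp
    have "0 \<le> (real M - 2 * (\<gamma> * real T)) / \<mu>" using gT T \<mu> by simp
    then have "real k \<le> (real M - 2 * (\<gamma> * real T)) / \<mu>" "(real M - 2 * (\<gamma> * real T)) / \<mu> \<le> real k + 1"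
      unfolding k_def by linarith+
    then have k: "\<mu> * real k \<le> real M - 2 * (\<gamma> * real T)" "real M - 2 * (\<gamma> * real T) \<le> \<mu> * real k + \<mu>"
      using \<mu> by (simp_all add: field_simps)
    have rT: "r \<le> T" using r gT T100 by linarith
    define T' where "T' = T - r"
    have T': "T' + r = T" "real T' = real T - real r" using rT by (auto simp: T'_def)
    have \<mu>r: "\<mu> * real r \<le> real r" using mult_right_mono[OF \<mu>(2), of "real r"] by simp
    have kT': "k \<le> T'"
    proof -
      have "\<mu> * real k \<le> \<mu> * real T'"
        unfolding T' right_diff_distrib using k gT r \<mu>r T RT by linarith
      then show ?thesis using \<mu> by simp
    qed
    have T'2: "2 \<le> T'" using T' r gT T100 by linarith
    define \<beta> where "\<beta> = (1 - real CARD('p) * \<eta>) * (1 / 2) powr (2 * ln (1 / \<delta>) / \<eta>\<^sup>2 * real (S + 2) / real n)"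
    have \<beta>: "exp (- e) \<le> \<beta>"
    proof -
      have "C * real (S + 2) / real n \<le> C * (2 * \<kappa>)"
        using S n\<kappa> n C by (simp add: divide_le_eq)
      also have "\<dots> * ln 2 = e / 2" using C by (simp add: \<kappa>_def)
      finally have le: "C * real (S + 2) / real n * ln 2 \<le> e / 2" by simp
      have "\<beta> = exp (- e / 2) * exp (- (C * real (S + 2) / real n * ln 2))"
        using \<eta> by (simp add: \<beta>_def q_def powr_def C_def ln_div)
      also have "\<dots> \<ge> exp (- e / 2) * exp (- (e / 2))" using le by (intro mult_left_mono) auto
      also have "exp (- e / 2) * exp (- (e / 2)) = exp (- e)" by (simp add: exp_add[symmetric])
      finally show ?thesis .
    qed
    have "\<beta> ^ T' * (1 - (1 / 2) ^ T' - 4 * exp (- (\<gamma>\<^sup>2 * real T / 4))) - exp (2 * \<delta> * real T' - \<gamma> * real T)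
        \<le> 2 powr (- a * real T)"
      unfolding \<beta>_def T'(1)[symmetric]
    proof (rule failure_probability_lower_bound[OF q2 n \<eta>(1) _ \<delta>(1) _ _ _ kT' mem])
      show "achieves_regret n (T' + r) M R (1 - 2 powr (- a * real (T' + r))) \<A>"
        using regret unfolding T'(1) .
      show "real M \<le> (1 - 1 / real CARD('p)) * real k - \<gamma> * real (T' + r) + real r"
        unfolding T' \<mu>_def[unfolded q_def, symmetric] using k r \<mu> by linarith
      show "real M + R * real (T' + r) \<le> (1 - 1 / real CARD('p)) * real T' - \<gamma> * real (T' + r)"
        unfolding T' \<mu>_def[unfolded q_def, symmetric] right_diff_distrib using gT r \<mu>r T by linarith
    qed (use \<eta> \<delta> \<gamma> \<gamma>1 k r \<mu> in \<open>auto simp: T' \<mu>_def q_def\<close>)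
    moreover have "exp (- e * real T) * (1 / 2) \<le> \<beta> ^ T' * (1 - (1 / 2) ^ T' - 4 * exp (- (\<gamma>\<^sup>2 * real T / 4)))"
    proof (rule mult_mono)
      have "exp (- e * real T) \<le> exp (- e * real T')" using e T' by simp
      also have "\<dots> = exp (- e) ^ T'" by (simp add: exp_of_nat_mult[symmetric] mult.commute)
      also have "\<dots> \<le> \<beta> ^ T'" by (intro power_mono \<beta>) simp
      finally show "exp (- e * real T) \<le> \<beta> ^ T'" .
      have "(1 / 2 :: real) ^ T' \<le> (1 / 2) ^ 2" using T'2 by (intro power_decreasing) auto
      moreover have "16 \<le> exp (\<gamma>\<^sup>2 * real T / 4)"
        using exp_ge_add_one_self[of "\<gamma>\<^sup>2 * real T / 4"] T(2) by linarith
      then have "exp (- (\<gamma>\<^sup>2 * real T / 4)) \<le> 1 / 16" by (simp add: exp_minus field_simps)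
      ultimately show "1 / 2 \<le> 1 - (1 / 2) ^ T' - 4 * exp (- (\<gamma>\<^sup>2 * real T / 4))"
        by (simp add: power2_eq_square)
      show "0 \<le> \<beta> ^ T'" using \<beta> exp_gt_zero[of "- e"] by (intro zero_le_power) linarith
    qed simp
    moreover have "exp (2 * \<delta> * real T' - \<gamma> * real T) \<le> exp (- e * real T) * exp (- e * real T)"
    proof -
      have "\<gamma> * real T' \<le> \<gamma> * real T" using \<gamma> T' by simp
      moreover have "2 * e * real T \<le> \<gamma> / 2 * real T" using e by (intro mult_right_mono) auto
      ultimately have "2 * \<delta> * real T' - \<gamma> * real T \<le> - e * real T + - e * real T"
        unfolding \<delta>_def by (simp add: algebra_simps)
      then show ?thesis unfolding exp_add[symmetric] by (simp only: exp_le_cancel_iff)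
    qed
    moreover have "2 powr (- a * real T) \<le> exp (- e * real T) * exp (- e * real T)"
    proof -
      have "2 * e * real T \<le> a * ln 2 * real T" using e by (intro mult_right_mono) auto
      then have "- a * real T * ln 2 \<le> - e * real T + - e * real T" by (simp add: algebra_simps)
      then show ?thesis unfolding exp_add[symmetric] powr_def by (simp add: mult_ac)
    qed
    \<comment> \<open>Both error terms are moved to the right. Cancelling one factor leaves
      \<open>exp (- e * T) \<ge> 1 / 4\<close>, whereas \<open>4 \<le> e * T\<close> forces it to be
      at most \<open>1 / 5\<close>.\<close>
    ultimately have "exp (- e * real T) * (1 / 2) \<le> exp (- e * real T) * (2 * exp (- e * real T))"
      by linarith
    then have "1 / 2 \<le> 2 * exp (- e * real T)" by (simp only: mult_le_cancel_left_pos exp_gt_zero)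
    moreover have "5 \<le> exp (e * real T)"
      using exp_ge_add_one_self[of "e * real T"] T(3) by linarith
    then have "exp (- e * real T) \<le> 1 / 5" by (simp add: exp_minus field_simps)
    ultimately show False by simp
  qed
  then show ?thesis using \<kappa> by blast
qed

end
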